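(* Let $A$ be a unital C*-algebra. Every standard frame of $\mathcal H=l_2(A)$ is a multiple of the sum of an orthonormal basis of $\mathcal H$ and a Riesz basis of $\mathcal H$; that is, for every standard frame $\{f_j\}_{j\in\mathbb N}$ of $\mathcal H$ there are a scalar $\lambda$, an orthonormal basis $\{g_j\}_{j\in\mathbb N}$ and a Riesz basis $\{h_j\}_{j\in\mathbb N}$ of $\mathcal H$ such that $f_j=\lambda(g_j+h_j)$ for every $j\in\mathbb N$.
   Context: $l_2(A)=\{\{a_i\}_{i\in\mathbb N}: a_i\in A,\ \sum_i a_ia_i^*\text{ converges in norm}\}$ is a left Hilbert $A$-module with $\langle a,b\rangle=\sum_i a_ib_i^*$. A sequence $\{x_j\}_j$ in a Hilbert $A$-module $\mathcal H$ is a frame if there are real constants $C,D>0$ with $C\langle x,x\rangle\le\sum_j\langle x,x_j\rangle\langle x_j,x\rangle\le D\langle x,x\rangle$ for every $x\in\mathcal H$; it is standard if the middle sum converges in norm for every $x$. A (standard) Riesz basis of $\mathcal H$ is a standard frame $\{x_j\}_j$ that is a generating set (finite $A$-linear combinations are norm-dense) with the additional property that $A$-linear combinations $\sum_{j\in S}a_jx_j$ with coefficients $a_j\in A$ and $S$ a subset of the index set are equal to zero if and only if every summand $a_jx_j$, $j\in S$, equals zero. An orthonormal basis of $l_2(A)$ is a generating sequence $\{g_j\}_j$ with $\langle g_i,g_j\rangle=\delta_{ij}1_A$. *)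

theory Defs
  imports "HOL-Analysis.Analysis"
begin

text \<open>Unital C*-algebras. The unit comes from \<^class>\<open>monoid_mult\<close> rather than from a class
  requiring \<open>0 \<noteq> 1\<close>, so the zero algebra is not excluded.\<close>

class unital_cstar_algebra = real_normed_algebra + monoid_mult + banach +
  fixes scaleC :: "complex \<Rightarrow> 'a \<Rightarrow> 'a"  (infixr "*\<^sub>C" 75)
    and star :: "'a \<Rightarrow> 'a"  ("_\<^sup>\<star>" [1000] 999)
  assumes scaleC_add_right: "z *\<^sub>C (x + y) = z *\<^sub>C x + z *\<^sub>C y"
    and scaleC_add_left: "(z + w) *\<^sub>C x = z *\<^sub>C x + w *\<^sub>C x"
    and scaleC_scaleC: "z *\<^sub>C (w *\<^sub>C x) = (z * w) *\<^sub>C x"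
    and scaleC_of_real: "complex_of_real r *\<^sub>C x = r *\<^sub>R x"
    and mult_scaleC_left: "(z *\<^sub>C x) * y = z *\<^sub>C (x * y)"
    and mult_scaleC_right: "x * (z *\<^sub>C y) = z *\<^sub>C (x * y)"
    and norm_scaleC: "norm (z *\<^sub>C x) = cmod z * norm x"
    and star_add: "(x + y)\<^sup>\<star> = x\<^sup>\<star> + y\<^sup>\<star>"
    and star_scaleC: "(z *\<^sub>C x)\<^sup>\<star> = cnj z *\<^sub>C x\<^sup>\<star>"
    and star_mult: "(x * y)\<^sup>\<star> = y\<^sup>\<star> * x\<^sup>\<star>"
    and star_star: "(x\<^sup>\<star>)\<^sup>\<star> = x"
    and cstar_identity: "norm (x\<^sup>\<star> * x) = (norm x)\<^sup>2"

definition cstar_spectrum :: "'a::unital_cstar_algebra \<Rightarrow> complex set" where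
  "cstar_spectrum a = {z. \<not> (\<exists>b. (a - z *\<^sub>C 1) * b = 1 \<and> b * (a - z *\<^sub>C 1) = 1)}"

definition cstar_positive :: "'a::unital_cstar_algebra \<Rightarrow> bool" where
  "cstar_positive a \<longleftrightarrow> a\<^sup>\<star> = a \<and> cstar_spectrum a \<subseteq> \<real>\<^sub>\<ge>\<^sub>0"

definition cstar_le :: "'a::unital_cstar_algebra \<Rightarrow> 'a \<Rightarrow> bool"  (infix "\<sqsubseteq>" 50) where
  "a \<sqsubseteq> b \<longleftrightarrow> cstar_positive (b - a)"

text \<open>The left Hilbert \<open>A\<close>-module \<open>l\<^sub>2(A)\<close> is a carrier set of sequences with pointwise addition and
  with the action \<open>a \<cdot> x = (\<lambda>i. a * x i)\<close>. Its norm is the usual Hilbert module norm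
  \<open>\<parallel>\<langle>x, x\<rangle>\<parallel>\<^sup>1\<^sup>/\<^sup>2\<close>.\<close>

definition l2_module :: "(nat \<Rightarrow> 'a::unital_cstar_algebra) set" where
  "l2_module = {x. summable (\<lambda>i. x i * (x i)\<^sup>\<star>)}"

definition l2_inner :: "(nat \<Rightarrow> 'a::unital_cstar_algebra) \<Rightarrow> (nat \<Rightarrow> 'a) \<Rightarrow> 'a" where
  "l2_inner x y = (\<Sum>i. x i * (y i)\<^sup>\<star>)"

definition l2_norm :: "(nat \<Rightarrow> 'a::unital_cstar_algebra) \<Rightarrow> real" where
  "l2_norm x = sqrt (norm (l2_inner x x))"

text \<open>In the predicates below, \<open>x j\<close> is the \<open>j\<close>-th member of a sequence in \<open>l\<^sub>2(A)\<close>, so \<open>x j i\<close> is the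
  \<open>i\<close>-th coordinate of that member.\<close>

definition standard_frame :: "(nat \<Rightarrow> nat \<Rightarrow> 'a::unital_cstar_algebra) \<Rightarrow> bool" where
  "standard_frame x \<longleftrightarrow> (\<forall>j. x j \<in> l2_module) \<and>
     (\<forall>y\<in>l2_module. summable (\<lambda>j. l2_inner y (x j) * l2_inner (x j) y)) \<and>
     (\<exists>C D::real. C > 0 \<and> D > 0 \<and>
       (\<forall>y\<in>l2_module.
          C *\<^sub>R l2_inner y y \<sqsubseteq> (\<Sum>j. l2_inner y (x j) * l2_inner (x j) y) \<and>
          (\<Sum>j. l2_inner y (x j) * l2_inner (x j) y) \<sqsubseteq> D *\<^sub>R l2_inner y y))"

definition generating :: "(nat \<Rightarrow> nat \<Rightarrow> 'a::unital_cstar_algebra) \<Rightarrow> bool" where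
  "generating x \<longleftrightarrow> (\<forall>j. x j \<in> l2_module) \<and>
     (\<forall>y\<in>l2_module. \<forall>\<epsilon>>0. \<exists>F a. finite F \<and> l2_norm (\<lambda>i. y i - (\<Sum>j\<in>F. a j * x j i)) < \<epsilon>)"

text \<open>The linear combinations in the definition of a Riesz basis may be infinite. That
  \<open>\<Sum>j\<in>S. a j \<cdot> x j\<close> equals zero means that its partial sums, taken in the order of the
  indices, converge to zero in the norm of \<open>l\<^sub>2(A)\<close>.\<close>

definition combination_eq_0 ::
  "nat set \<Rightarrow> (nat \<Rightarrow> 'a::unital_cstar_algebra) \<Rightarrow> (nat \<Rightarrow> nat \<Rightarrow> 'a) \<Rightarrow> bool" where
  "combination_eq_0 S a x \<longleftrightarrow>
     (\<lambda>n. l2_norm (\<lambda>i. \<Sum>j\<in>S \<inter> {..<n}. a j * x j i)) \<longlonglongrightarrow> 0"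

definition riesz_basis :: "(nat \<Rightarrow> nat \<Rightarrow> 'a::unital_cstar_algebra) \<Rightarrow> bool" where
  "riesz_basis x \<longleftrightarrow> standard_frame x \<and> generating x \<and>
     (\<forall>S a. combination_eq_0 S a x \<longleftrightarrow> (\<forall>j\<in>S. (\<lambda>i. a j * x j i) = (\<lambda>i. 0)))"

definition orthonormal_basis :: "(nat \<Rightarrow> nat \<Rightarrow> 'a::unital_cstar_algebra) \<Rightarrow> bool" where
  "orthonormal_basis x \<longleftrightarrow> generating x \<and>
     (\<forall>i j. l2_inner (x i) (x j) = (if i = j then 1 else 0))"

end

theory Submission
  imports Defs
begin

text \<open>Let \<open>D\<close> be an upper frame bound of \<open>f\<close>, let \<open>T\<close> be the synthesis operator \<open>T e\<^sub>j = f\<^sub>j\<close> and put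
  \<open>\<lambda> = 2\<surd>D\<close>. Then \<open>\<parallel>T / \<lambda>\<parallel> \<le> 1/2\<close>, so \<open>T / \<lambda> - 1\<close> is invertible and maps the standard basis \<open>e\<close> to a
  Riesz basis \<open>h\<close>, while \<open>f\<^sub>j = \<lambda> (e\<^sub>j + h\<^sub>j)\<close>. Completeness of \<open>l\<^sub>2(A)\<close> is avoided by working with finite
  combinations, and the frame inequalities for \<open>h\<close> come from expanding squares. This needs that the
  elements \<open>c c\<^sup>\<star>\<close> are positive in the sense of the spectrum and that the norm is monotone on positive
  elements. Both rest on the fact that a self-adjoint \<open>b\<close> cannot have \<open>\<parallel>b\<parallel> - b\<close> and \<open>\<parallel>b\<parallel> + b\<close> both
  invertible.\<close>

subsection \<open>Involution and invertible elements\<close>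

text \<open>The order of A is defined by spectra, so even the positivity of a sum is not immediate.
  The way out is to express positivity of a self-adjoint \<open>a\<close> by
  \<open>norm (t *\<^sub>R 1 - a) \<le> t\<close> for a suitable \<open>t\<close>: sums then follow
  from the triangle inequality and limits from continuity. Passing from the spectrum to this
  inequality needs the norm of a self-adjoint element to be visible in its spectrum. This is proved
  as in the elementary approach to the spectral radius formula, by averaging inverses over roots of
  unity, with the C*-identity controlling the powers with exponent a power of two. The frame
  condition bounds the analysis map, which sends y to the coefficients
  \<open>l2_inner y (f j)\<close>; Cauchy-Schwarz transfers the bound to T. Since the frame
  inequalities for \<open>h\<close> have values in A, the triangle inequality for norms cannot give
  them, and parallelogram identities in A take its place. The factor 2 in \<lambda> makes T /
  \<lambda> a contraction that at least halves norms, which gives both the lower bound on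
  combinations of the \<open>h j\<close> and a geometric approximation scheme for their
  density.\<close>

lemma scaleC_one [simp]: "1 *\<^sub>C x = (x::'a::unital_cstar_algebra)"
  using scaleC_of_real[of 1 x] by simp

lemma scaleC_zero_left [simp]: "0 *\<^sub>C x = (0::'a::unital_cstar_algebra)"
  using scaleC_of_real[of 0 x] by simp

lemma scaleC_minus_left: "(- z) *\<^sub>C x = - (z *\<^sub>C x :: 'a::unital_cstar_algebra)"
  using scaleC_add_left[of z "-z" x] by (simp add: eq_neg_iff_add_eq_0 add.commute)

lemma scaleC_diff_left: "(z - w) *\<^sub>C x = z *\<^sub>C x - (w *\<^sub>C x :: 'a::unital_cstar_algebra)"
  using scaleC_add_left[of z "-w" x] by (simp add: scaleC_minus_left)

lemma scaleC_minus_right: "z *\<^sub>C (- x) = - (z *\<^sub>C x :: 'a::unital_cstar_algebra)"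
  using scaleC_scaleC[of z "-1" x] by (simp add: scaleC_minus_left)

lemma scaleC_diff_right: "z *\<^sub>C (x - y) = z *\<^sub>C x - (z *\<^sub>C y :: 'a::unital_cstar_algebra)"
  using scaleC_add_right[of z x "- y"] by (simp add: scaleC_minus_right)

lemma star_one [simp]: "(1::'a::unital_cstar_algebra)\<^sup>\<star> = 1"
  by (metis mult_1_left mult_1_right star_mult star_star)

lemma star_scaleR [simp]: "(r *\<^sub>R x)\<^sup>\<star> = r *\<^sub>R (x::'a::unital_cstar_algebra)\<^sup>\<star>"
  using star_scaleC[of "complex_of_real r" x] by (simp add: scaleC_of_real)

lemma star_zero [simp]: "(0::'a::unital_cstar_algebra)\<^sup>\<star> = 0"
  using star_scaleR[of 0 "0::'a"] by simp

lemma star_minus [simp]: "(- x)\<^sup>\<star> = - (x::'a::unital_cstar_algebra)\<^sup>\<star>"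
  using star_scaleR[of "-1" x] by simp

lemma star_diff: "(x - y)\<^sup>\<star> = x\<^sup>\<star> - (y::'a::unital_cstar_algebra)\<^sup>\<star>"
  using star_add[of x "-y"] by simp

lemma star_sum: "(\<Sum>i\<in>F. x i)\<^sup>\<star> = (\<Sum>i\<in>F. (x i :: 'a::unital_cstar_algebra)\<^sup>\<star>)"
  by (induction F rule: infinite_finite_induct) (auto simp: star_add)

text \<open>The C*-identity makes this norm equal to its own square, so it is 0 or 1; it is 0 in the
  zero algebra.\<close>

lemma norm_one_le: "norm (1::'a::unital_cstar_algebra) \<le> 1"
proof -
  have "norm (1::'a) = (norm (1::'a))\<^sup>2" using cstar_identity[of "1::'a"] by simp
  then show ?thesis by (metis less_eq_real_def mult_cancel_right2 power2_eq_square zero_le_one)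
qed

lemma norm_star [simp]: "norm (x\<^sup>\<star>) = norm (x::'a::unital_cstar_algebra)"
proof -
  have le: "norm y \<le> norm (y\<^sup>\<star>)" for y :: 'a
  proof (cases "norm y = 0")
    case False
    have "norm y * norm y \<le> norm (y\<^sup>\<star>) * norm y"
      using cstar_identity[of y] norm_mult_ineq[of "y\<^sup>\<star>" y] by (simp add: power2_eq_square)
    with False show ?thesis by (simp add: mult_le_cancel_right)
  qed simp
  show ?thesis using le[of x] le[of "x\<^sup>\<star>"] by (simp add: star_star)
qed

lemma norm_mult_star: "norm (x * x\<^sup>\<star>) = (norm (x::'a::unital_cstar_algebra))\<^sup>2"
  using cstar_identity[of "x\<^sup>\<star>"] by (simp add: star_star)

lemma bounded_linear_star: "bounded_linear (star :: 'a::unital_cstar_algebra \<Rightarrow> 'a)"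
  by (rule bounded_linear_intro[of _ 1]) (auto simp: star_add)

section \<open>Inverses, Neumann series and perturbation\<close>

definition inverse_pair :: "'a::unital_cstar_algebra \<Rightarrow> 'a \<Rightarrow> bool" where
  "inverse_pair a b \<longleftrightarrow> a * b = 1 \<and> b * a = 1"

text \<open>Forgets the inverse; \<open>inverse_pair\<close> keeps it where its norm has to be
  estimated.\<close>

definition cunit :: "'a::unital_cstar_algebra \<Rightarrow> bool" where
  "cunit a \<longleftrightarrow> (\<exists>b. inverse_pair a b)"

lemma inverse_pair_unique:
  "inverse_pair a b \<Longrightarrow> inverse_pair a c \<Longrightarrow> b = c"
  unfolding inverse_pair_def by (metis mult.assoc mult_1_left mult_1_right)

lemma cunit_scaleR:
  assumes "cunit a" "r \<noteq> 0"
  shows "cunit (r *\<^sub>R a)"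
proof -
  obtain b where "a * b = 1" "b * a = 1" using assms(1) by (auto simp: cunit_def inverse_pair_def)
  then have "inverse_pair (r *\<^sub>R a) (inverse r *\<^sub>R b)" using assms(2) by (simp add: inverse_pair_def)
  then show ?thesis by (auto simp: cunit_def)
qed

lemma cunit_scaleC:
  assumes "cunit a" "z \<noteq> 0"
  shows "cunit (z *\<^sub>C a)"
proof -
  obtain b where "a * b = 1" "b * a = 1" using assms(1) by (auto simp: cunit_def inverse_pair_def)
  then have "inverse_pair (z *\<^sub>C a) (inverse z *\<^sub>C b)"
    using assms(2) by (simp add: inverse_pair_def mult_scaleC_left mult_scaleC_right scaleC_scaleC)
  then show ?thesis by (auto simp: cunit_def)
qed

lemma cunit_minus: "cunit a \<Longrightarrow> cunit (- a)"
  using cunit_scaleR[of a "-1"] by simp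

text \<open>The inverse of the product yields a left and a right inverse of \<open>x\<close>, and
  these coincide.\<close>

lemma cunit_mult_commD:
  assumes "x * y = y * x" "cunit (x * y)"
  shows "cunit x"
proof -
  obtain z where "x * y * z = 1" "z * (x * y) = 1" using assms by (auto simp: cunit_def inverse_pair_def)
  then have 1: "x * (y * z) = 1" "(z * y) * x = 1" by (metis mult.assoc, metis assms(1) mult.assoc)
  then have "z * y = y * z" by (metis mult.assoc mult_1_left mult_1_right)
  with 1 show ?thesis by (auto simp: cunit_def inverse_pair_def)
qed

lemma norm_power_le: "norm ((x::'a::unital_cstar_algebra) ^ n) \<le> norm x ^ n"
proof (induction n)
  case 0 show ?case by (simp add: norm_one_le)
next
  case (Suc n)
  have "norm (x ^ Suc n) \<le> norm x * norm (x ^ n)" by (simp add: norm_mult_ineq)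
  also have "\<dots> \<le> norm x * norm x ^ n" using Suc by (simp add: mult_left_mono)
  finally show ?case by simp
qed

text \<open>The estimate comes from \<open>b - 1 = x * b\<close>, hence
  \<open>norm (b - 1) \<le> norm x * (norm (b - 1) + 1)\<close>, solved for
  \<open>norm (b - 1)\<close>.\<close>

lemma neumann:
  fixes x :: "'a::unital_cstar_algebra"
  assumes "norm x < 1"
  shows "\<exists>b. inverse_pair (1 - x) b \<and> norm (b - 1) \<le> norm x / (1 - norm x)"
proof -
  have s: "summable (\<lambda>n. x ^ n)"
    by (rule summable_comparison_test'[of "\<lambda>n. norm x ^ n" 0])
       (auto simp: norm_power_le summable_geometric assms)
  define b where "b = (\<Sum>n. x ^ n)"
  have b: "b - 1 = (\<Sum>n. x ^ Suc n)"
    unfolding b_def using suminf_split_head[OF s] by simp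
  have 1: "x * b = b - 1" unfolding b unfolding b_def using suminf_mult[OF s, of x] by simp
  have 2: "b * x = b - 1" unfolding b unfolding b_def using suminf_mult2[OF s, of x]
    by (simp add: power_commutes)
  have "inverse_pair (1 - x) b" using 1 2 by (simp add: inverse_pair_def algebra_simps)
  moreover have "norm (b - 1) \<le> norm x / (1 - norm x)"
  proof -
    have "norm b \<le> norm (b - 1) + 1" using norm_triangle_ineq[of "b - 1" 1] norm_one_le[where 'a='a] by simp
    then have "norm (b - 1) \<le> norm x * (norm (b - 1) + 1)"
      using norm_mult_ineq[of x b] by (metis 1 mult_left_mono norm_ge_zero order_trans)
    then show ?thesis using assms by (simp add: field_simps)
  qed
  ultimately show ?thesis by blast
qed

lemma cunit_diff_scaleC:
  assumes "norm x < cmod z"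
  shows "cunit (x - z *\<^sub>C 1)"
proof -
  have z: "z \<noteq> 0" using assms by (metis norm_ge_zero norm_zero not_less)
  have "norm (inverse z *\<^sub>C x) < 1" using assms z by (simp add: norm_scaleC norm_inverse) (simp add: divide_simps)
  then have "cunit (1 - inverse z *\<^sub>C x)" using neumann by (auto simp: cunit_def)
  then have "cunit ((- z) *\<^sub>C (1 - inverse z *\<^sub>C x))" using z by (intro cunit_scaleC) auto
  moreover have "(- z) *\<^sub>C (1 - inverse z *\<^sub>C x) = x - z *\<^sub>C 1"
    using z by (simp add: scaleC_diff_right scaleC_minus_left scaleC_scaleC)
  ultimately show ?thesis by simp
qed

lemma cunit_diff_scaleR:
  assumes "norm x < \<bar>r\<bar>"
  shows "cunit (x - r *\<^sub>R 1)"
  using cunit_diff_scaleC[of x "complex_of_real r"] assms by (simp add: scaleC_of_real)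

text \<open>Factor \<open>a + d = a * (1 + b * d)\<close> and invert the second factor by a Neumann
  series. The smallness hypothesis keeps its denominator at least 1/2, whence the factor 2.\<close>

lemma inverse_pair_perturb:
  fixes a b d :: "'a::unital_cstar_algebra"
  assumes "inverse_pair a b" "norm b \<le> M" "norm d * M \<le> 1/2"
  shows "\<exists>c. inverse_pair (a + d) c \<and> norm (c - b) \<le> 2 * M\<^sup>2 * norm d"
proof -
  have M: "M \<ge> 0" using assms(2) norm_ge_zero[of b] by linarith
  have "norm (b * d) \<le> norm b * norm d" by (rule norm_mult_ineq)
  also have "\<dots> \<le> M * norm d" using assms(2) by (simp add: mult_right_mono)
  finally have bd: "norm (b * d) \<le> M * norm d" .
  then have h: "norm (b * d) \<le> 1/2" using assms(3) by (simp add: mult.commute)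
  obtain n where n: "inverse_pair (1 - (- (b * d))) n"
    "norm (n - 1) \<le> norm (- (b * d)) / (1 - norm (- (b * d)))"
    using neumann[of "- (b * d)"] h by auto
  have "norm (b * d) / (1 - norm (b * d)) \<le> 2 * norm (b * d)"
    using h mult_right_mono[OF h, of "2 * norm (b*d)"] by (simp add: field_simps)
  with n(2) bd have n1: "norm (n - 1) \<le> 2 * (M * norm d)" by simp
  have n': "(1 + b * d) * n = 1" "n * (1 + b * d) = 1" using n(1) by (auto simp: inverse_pair_def)
  have ad: "a + d = a * (1 + b * d)" using assms(1)
    by (simp add: inverse_pair_def distrib_left flip: mult.assoc)
  have "inverse_pair (a + d) (n * b)"
  proof -
    have "a * (1 + b * d) * (n * b) = a * ((1 + b * d) * n) * b" by (simp only: mult.assoc)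
    moreover have "n * b * (a * (1 + b * d)) = n * (b * a) * (1 + b * d)" by (simp only: mult.assoc)
    ultimately show ?thesis using n' assms(1) by (simp add: inverse_pair_def ad)
  qed
  moreover have "norm (n * b - b) \<le> 2 * M\<^sup>2 * norm d"
  proof -
    have "norm (n * b - b) = norm ((n - 1) * b)" by (simp add: left_diff_distrib)
    also have "\<dots> \<le> norm (n - 1) * norm b" by (rule norm_mult_ineq)
    also have "\<dots> \<le> (2 * (M * norm d)) * M" using n1 assms(2) M by (intro mult_mono) auto
    finally show ?thesis by (simp add: power2_eq_square mult_ac)
  qed
  ultimately show ?thesis by blast
qed

text \<open>For real \<open>m\<close>, \<open>\<parallel>a + im\<parallel>\<^sup>2 \<le> \<parallel>a\<parallel>\<^sup>2 + m\<^sup>2\<close>, which is less than \<open>\<bar>z + im\<bar>\<^sup>2\<close> when \<open>m\<close> is large of the same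
  sign as \<open>Im z\<close>.\<close>
lemma selfadjoint_spectrum_real:
  fixes a :: "'a::unital_cstar_algebra"
  assumes "a\<^sup>\<star> = a" "Im z \<noteq> 0"
  shows "cunit (a - z *\<^sub>C 1)"
proof -
  \<comment> \<open>With this \<open>m\<close> the square of \<open>cmod (z + w)\<close> exceeds
    \<open>(norm a)\<^sup>2 + m\<^sup>2\<close> by at least 1.\<close>
  define m where "m = ((norm a)\<^sup>2 + 1) / (2 * Im z)"
  define w where "w = Complex 0 m"
  have m: "2 * Im z * m = (norm a)\<^sup>2 + 1" using assms(2) by (simp add: m_def)
  have "(a + w *\<^sub>C 1)\<^sup>\<star> * (a + w *\<^sub>C 1) = a * a + (cnj w * w) *\<^sub>C 1 + (cnj w + w) *\<^sub>C a"
    using assms(1) by (simp add: star_add star_scaleC algebra_simps mult_scaleC_left mult_scaleC_right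
       scaleC_scaleC scaleC_add_left scaleC_add_right)
  also have "cnj w * w = complex_of_real (m\<^sup>2)" by (simp add: w_def complex_eq_iff power2_eq_square)
  also have "cnj w + w = 0" by (simp add: w_def complex_eq_iff)
  finally have e: "(a + w *\<^sub>C 1)\<^sup>\<star> * (a + w *\<^sub>C 1) = a * a + m\<^sup>2 *\<^sub>R 1"
    by (simp only: scaleC_of_real scaleC_zero_left add_0_right)
  have "(norm (a + w *\<^sub>C 1))\<^sup>2 = norm (a * a + m\<^sup>2 *\<^sub>R 1)"
    using cstar_identity[of "a + w *\<^sub>C 1"] by (simp add: e)
  also have "\<dots> \<le> norm (a * a) + m\<^sup>2 * norm (1::'a)" by (rule order_trans[OF norm_triangle_ineq]) simp
  also have "\<dots> \<le> (norm a)\<^sup>2 + m\<^sup>2"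
    using norm_mult_ineq[of a a] norm_one_le[where 'a='a] mult_left_mono[OF norm_one_le[where 'a='a], of "m\<^sup>2"]
    by (simp add: power2_eq_square)
  also have "\<dots> < (cmod (z + w))\<^sup>2"
  proof -
    have "(cmod (z + w))\<^sup>2 = (Re z)\<^sup>2 + (Im z + m)\<^sup>2" by (simp add: cmod_power2 w_def)
    also have "\<dots> = (Re z)\<^sup>2 + (Im z)\<^sup>2 + 2 * Im z * m + m\<^sup>2" by (simp add: power2_sum)
    finally show ?thesis unfolding m using zero_le_power2[of "Re z"] zero_le_power2[of "Im z"] by linarith
  qed
  finally have "norm (a + w *\<^sub>C 1) < cmod (z + w)" by (rule power_less_imp_less_base) simp
  then have "cunit (a + w *\<^sub>C 1 - (z + w) *\<^sub>C 1)" by (rule cunit_diff_scaleC)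
  then show ?thesis by (simp add: scaleC_add_left)
qed

text \<open>Partial fractions: multiplying either inverse by \<open>1 - w * w\<close> leaves the
  other factor, and the two factors add up to 2.\<close>

lemma inverse_pair_diff_square:
  assumes "inverse_pair (1 - w) x" "inverse_pair (1 + w) y"
  shows "inverse_pair (1 - w * w) ((1/2) *\<^sub>R (x + y))"
proof -
  have f: "1 - w * w = (1 + w) * (1 - w)" "1 - w * w = (1 - w) * (1 + w)" by (simp_all add: algebra_simps)
  have "(1 - w * w) * x = 1 + w" unfolding f(1) using assms(1) by (simp add: inverse_pair_def mult.assoc)
  moreover have "(1 - w * w) * y = 1 - w" unfolding f(2) using assms(2) by (simp add: inverse_pair_def mult.assoc)
  moreover have "x * (1 - w * w) = 1 + w" unfolding f(2) using assms(1) by (simp add: inverse_pair_def flip: mult.assoc)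
  moreover have "y * (1 - w * w) = 1 - w" unfolding f(1) using assms(2) by (simp add: inverse_pair_def flip: mult.assoc)
  ultimately show ?thesis unfolding inverse_pair_def
    by (simp add: distrib_left distrib_right flip: scaleR_2)
qed

text \<open>Compactness: by perturbation, inverses near a point of the circle have a common norm
  bound.\<close>

lemma circle_inverse_bounded:
  fixes b :: "'a::unital_cstar_algebra"
  assumes "\<And>u. cmod u = 1 \<Longrightarrow> cunit (1 - u *\<^sub>C b)"
  shows "\<exists>M. \<forall>u. cmod u = 1 \<longrightarrow> (\<exists>x. inverse_pair (1 - u *\<^sub>C b) x \<and> norm x \<le> M)"
proof -
  obtain X where X: "\<And>u. cmod u = 1 \<Longrightarrow> inverse_pair (1 - u *\<^sub>C b) (X u)"
    using assms unfolding cunit_def by metis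
  \<comment> \<open>Chosen so that
    \<open>norm ((u - v) *\<^sub>C b) * (norm (X u) + 1) \<le> 1/2\<close> on the ball, as the
    perturbation lemma requires.\<close>
  define r where "r u = 1 / (2 * (norm (X u) + 1) * (norm b + 1))" for u
  have rpos: "r u > 0" for u unfolding r_def
    by (intro divide_pos_pos mult_pos_pos) (auto intro: add_nonneg_pos)
  have loc: "\<exists>x. inverse_pair (1 - v *\<^sub>C b) x \<and> norm x \<le> 3 * (norm (X u) + 1)\<^sup>2"
    if u: "cmod u = 1" and v: "v \<in> ball u (r u)" for u v
  proof -
    define M where "M = norm (X u) + 1"
    define d where "d = (u - v) *\<^sub>C b"
    have M: "M \<ge> 1" by (simp add: M_def)
    have "cmod (u - v) \<le> r u" using v by (simp add: dist_norm)
    then have "norm d \<le> r u * (norm b + 1)" using rpos[of u] unfolding d_def norm_scaleC by (intro mult_mono) auto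
    also have "\<dots> = 1 / (2 * M)" using norm_ge_zero[of b] by (simp add: r_def M_def add_nonneg_eq_0_iff)
    finally have d: "norm d * M \<le> 1/2" using M by (simp add: field_simps)
    obtain c where c: "inverse_pair (1 - u *\<^sub>C b + d) c" "norm (c - X u) \<le> 2 * M\<^sup>2 * norm d"
      using inverse_pair_perturb[OF X[OF u], of M d] d by (auto simp: M_def)
    have "2 * M\<^sup>2 * norm d = 2 * M * (norm d * M)" by (simp add: power2_eq_square)
    also have "\<dots> \<le> 2 * M * (1/2)" using d M by (intro mult_left_mono) auto
    finally have "norm (c - X u) \<le> M" using c(2) by simp
    then have "norm c \<le> 2 * M" using norm_triangle_ineq[of "c - X u" "X u"] by (simp add: M_def)
    also have "\<dots> \<le> 3 * M\<^sup>2" using M by (simp add: power2_eq_square)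
    finally show ?thesis using c(1) by (auto simp: d_def scaleC_diff_left M_def)
  qed
  obtain C where C: "C \<subseteq> sphere (0::complex) 1" "finite C" "sphere 0 1 \<subseteq> (\<Union>u\<in>C. ball u (r u))"
    by (rule compactE_image[of "sphere (0::complex) 1" "sphere 0 1" "\<lambda>u. ball u (r u)"])
       (use rpos in auto)
  define M where "M = (\<Sum>u\<in>C. 3 * (norm (X u) + 1)\<^sup>2)"
  have "\<exists>x. inverse_pair (1 - v *\<^sub>C b) x \<and> norm x \<le> M" if v: "cmod v = 1" for v
  proof -
    from v C(3) obtain u where u: "u \<in> C" "v \<in> ball u (r u)" by force
    moreover have "3 * (norm (X u) + 1)\<^sup>2 \<le> M" unfolding M_def using u C(2)
      by (intro member_le_sum) auto
    ultimately show ?thesis using loc[of u v] C(1) by (force intro: order_trans)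
  qed
  then show ?thesis by blast
qed

subsection \<open>Norm and spectrum of self-adjoint elements\<close>

text \<open>For self-adjoint elements the C*-identity says that squaring an element squares its
  norm. Hence the exponents are powers of two.\<close>

lemma selfadjoint_power_norm:
  fixes b :: "'a::unital_cstar_algebra"
  assumes "b\<^sup>\<star> = b" "norm b = 1"
  shows "(b ^ 2 ^ k)\<^sup>\<star> = b ^ 2 ^ k \<and> norm (b ^ 2 ^ k) = 1"
proof (induction k)
  case (Suc k)
  have e: "b ^ 2 ^ Suc k = b ^ 2 ^ k * b ^ 2 ^ k" by (simp add: mult_2 power_add)
  show ?case using Suc cstar_identity[of "b ^ 2 ^ k"] unfolding e by (simp add: star_mult)
qed (use assms in simp)

text \<open>The inverse of \<open>1 - w\<^sup>2\<close> is the mean of the inverses of \<open>1 - w\<close> and \<open>1 + w\<close>, so an estimate that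
  is uniform on the unit circle passes from \<open>b\<close> to \<open>b\<^sup>2\<close>.\<close>
lemma circle_inverse_doubling:
  fixes b :: "'a::unital_cstar_algebra"
  assumes "\<And>u. cmod u = 1 \<Longrightarrow> \<exists>x y. inverse_pair (1 - u *\<^sub>C b) x \<and>
             inverse_pair (1 - u *\<^sub>C q *\<^sub>R b) y \<and> norm (x - y) \<le> e" "cmod u = 1"
  shows "\<exists>x y. inverse_pair (1 - u *\<^sub>C b ^ 2 ^ k) x \<and>
             inverse_pair (1 - u *\<^sub>C (q *\<^sub>R b) ^ 2 ^ k) y \<and> norm (x - y) \<le> e"
  using assms(2)
proof (induction k arbitrary: u)
  case 0
  then show ?case using assms(1) by simp
next
  case (Suc k)
  \<comment> \<open>Both square roots of \<open>u\<close>, namely \<open>v\<close> and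
    \<open>- v\<close>, lie on the circle, and the induction hypothesis is applied to each. Over all
    steps this averages over the roots of \<open>u\<close> of order \<open>2 ^ k\<close>.\<close>
  define v where "v = csqrt u"
  have v: "v * v = u" by (metis v_def power2_csqrt power2_eq_square)
  have nv: "cmod v = 1" using Suc.prems by (metis norm_csqrt real_sqrt_one v_def)
  have sq: "u *\<^sub>C c ^ 2 ^ Suc k = (v *\<^sub>C c ^ 2 ^ k) * (v *\<^sub>C c ^ 2 ^ k)" for c :: 'a
    by (simp add: mult_2 power_add mult_scaleC_left mult_scaleC_right scaleC_scaleC v)
  obtain x1 y1 where 1: "inverse_pair (1 - v *\<^sub>C b ^ 2 ^ k) x1"
    "inverse_pair (1 - v *\<^sub>C (q *\<^sub>R b) ^ 2 ^ k) y1" "norm (x1 - y1) \<le> e"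
    using Suc.IH[OF nv] by blast
  obtain x2 y2 where 2: "inverse_pair (1 + v *\<^sub>C b ^ 2 ^ k) x2"
    "inverse_pair (1 + v *\<^sub>C (q *\<^sub>R b) ^ 2 ^ k) y2" "norm (x2 - y2) \<le> e"
    using Suc.IH[of "- v"] nv by (auto simp: scaleC_minus_left)
  have "(1/2) *\<^sub>R (x1 + x2) - (1/2) *\<^sub>R (y1 + y2) = (1/2) *\<^sub>R ((x1 - y1) + (x2 - y2))"
    by (simp add: algebra_simps)
  then have "norm ((1/2) *\<^sub>R (x1 + x2) - (1/2) *\<^sub>R (y1 + y2)) \<le> e"
    using norm_triangle_ineq[of "x1 - y1" "x2 - y2"] 1(3) 2(3) by simp
  then show ?case unfolding sq
    using inverse_pair_diff_square[OF 1(1) 2(1)] inverse_pair_diff_square[OF 1(2) 2(2)] by blast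
qed

text \<open>If both elements were invertible, then the inverses of \<open>1 - b\<^sup>m\<close> and \<open>1 - (q b)\<^sup>m\<close>, for \<open>m = 2\<^sup>n\<close> and
  some \<open>q < 1\<close>, would be close uniformly in \<open>m\<close>; but \<open>(q b)\<^sup>m\<close> tends to \<open>0\<close> while \<open>b\<^sup>m\<close> has norm \<open>1\<close>.\<close>
lemma selfadjoint_norm_one_not_cunit:
  fixes b :: "'a::unital_cstar_algebra"
  assumes sa: "b\<^sup>\<star> = b" and nb: "norm b = 1" and u1: "cunit (1 - b)" and u2: "cunit (1 + b)"
  shows False
proof -
  have unit: "cunit (1 - u *\<^sub>C b)" if u: "cmod u = 1" for u
  proof (cases "Im u = 0")
    case True
    then have "\<bar>Re u\<bar> = 1" using u by (simp add: cmod_def)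
    then have "u = 1 \<or> u = -1" using True by (auto simp: complex_eq_iff abs_if split: if_splits)
    then show ?thesis using u1 u2 by (auto simp: scaleC_minus_left)
  next
    case False
    have u0: "u \<noteq> 0" using False by auto
    have "Im (inverse u) \<noteq> 0" using False u by (simp add: complex_eq_iff cmod_def)
    then have "cunit (b - inverse u *\<^sub>C 1)" by (rule selfadjoint_spectrum_real[OF sa])
    then have "cunit ((- u) *\<^sub>C (b - inverse u *\<^sub>C 1))" using u0 by (intro cunit_scaleC) auto
    moreover have "(- u) *\<^sub>C (b - inverse u *\<^sub>C 1) = 1 - u *\<^sub>C b"
      using u0 by (simp add: scaleC_diff_right scaleC_scaleC scaleC_minus_left)
    ultimately show ?thesis by simp
  qed
  then obtain M where M: "\<And>u. cmod u = 1 \<Longrightarrow> \<exists>x. inverse_pair (1 - u *\<^sub>C b) x \<and> norm x \<le> M"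
    using circle_inverse_bounded[of b] by blast
  define N where "N = max M 1"
  have N: "N \<ge> 1" "M \<le> N" by (auto simp: N_def)
  \<comment> \<open>Makes the perturbation bound \<open>2 * N\<^sup>2 * s\<close> equal to
    1/8.\<close>
  define s where "s = 1 / (16 * N\<^sup>2)"
  define q where "q = 1 - s"
  have NN: "N\<^sup>2 \<ge> 1" using N by (simp add: one_le_power)
  have s: "0 < s" "s \<le> 1/2" using NN by (auto simp: s_def divide_simps)
  have q: "0 < q" "q < 1" using s by (auto simp: q_def)
  have base: "\<exists>x y. inverse_pair (1 - u *\<^sub>C b) x \<and>
             inverse_pair (1 - u *\<^sub>C q *\<^sub>R b) y \<and> norm (x - y) \<le> 1/8" if u: "cmod u = 1" for u
  proof -
    obtain x where x: "inverse_pair (1 - u *\<^sub>C b) x" "norm x \<le> N" using M[OF u] N by force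
    define d where "d = u *\<^sub>C s *\<^sub>R b"
    have d: "norm d = s" using u nb s by (simp add: d_def norm_scaleC)
    have "N \<le> N\<^sup>2" using N by (simp add: power2_eq_square)
    then have "s * N \<le> 1/2" using N by (simp add: s_def field_simps) 
    then obtain y where y: "inverse_pair (1 - u *\<^sub>C b + d) y" "norm (y - x) \<le> 2 * N\<^sup>2 * s"
      using inverse_pair_perturb[OF x, of d] d by auto
    have "2 * N\<^sup>2 * s = 1/8" using N by (simp add: s_def)
    have "u *\<^sub>C q *\<^sub>R b = u *\<^sub>C b - d"
      using scaleC_add_right[of u "q *\<^sub>R b" "s *\<^sub>R b"] by (simp add: d_def q_def flip: scaleR_left_distrib)
    then have "1 - u *\<^sub>C q *\<^sub>R b = 1 - u *\<^sub>C b + d" by simp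
    then have "inverse_pair (1 - u *\<^sub>C q *\<^sub>R b) y" using y(1) by (simp only:)
    moreover have "norm (x - y) \<le> 1/8" using y(2) \<open>2 * N\<^sup>2 * s = 1/8\<close> by (simp only: norm_minus_commute)
    ultimately show ?thesis using x(1) by blast
  qed
  have "(\<lambda>n. q ^ n) \<longlonglongrightarrow> 0" using q by (intro LIMSEQ_power_zero) auto
  then have "\<forall>\<^sub>F n in sequentially. q ^ n < 1/9" by (rule order_tendstoD) simp
  then obtain n where n: "\<And>m. m \<ge> n \<Longrightarrow> q ^ m < 1/9" by (auto simp: eventually_sequentially)
  \<comment> \<open>The bound 1/9 gives \<open>norm E / (1 - norm E) \<le> 1/8\<close>. Together
    with the 1/8 for \<open>x - y\<close>, this puts \<open>x\<close> within 1/4 of 1.\<close>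
  have "q ^ 2 ^ n < 1/9" by (rule n) simp
  define B where "B = b ^ 2 ^ n"
  have B: "norm B = 1" using selfadjoint_power_norm[OF sa nb] by (simp add: B_def)
  define E where "E = (q *\<^sub>R b) ^ 2 ^ n"
  have E: "norm E < 1/9" using norm_power_le[of "q *\<^sub>R b" "2 ^ n"] nb q \<open>q ^ 2 ^ n < 1/9\<close> by (simp add: E_def)
  obtain x y where xy: "inverse_pair (1 - B) x" "inverse_pair (1 - E) y" "norm (x - y) \<le> 1/8"
    using circle_inverse_doubling[of b q "1/8" 1 n] base by (auto simp: B_def E_def)
  obtain y' where y': "inverse_pair (1 - E) y'" "norm (y' - 1) \<le> norm E / (1 - norm E)"
    using neumann[of E] E by auto
  have "norm E / (1 - norm E) \<le> 1/8" using E by (simp add: field_simps)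
  then have "norm (y - 1) \<le> 1/8" using y'(2) inverse_pair_unique[OF xy(2) y'(1)] by (metis order_trans)
  then have x1: "norm (x - 1) \<le> 1/4"
    using norm_triangle_mono[OF xy(3) \<open>norm (y - 1) \<le> 1/8\<close>] by simp
  have "(1 - B) * x = 1" using xy(1) by (simp add: inverse_pair_def)
  \<comment> \<open>Here \<open>(1 - B) * (x - 1)\<close> is computed from
    \<open>(1 - B) * x = 1\<close>. The identity bounds \<open>norm B\<close> by 1/4 + 1/4, against
    \<open>norm B = 1\<close>.\<close>
  then have e: "B = (x - 1) - B * (x - 1)" by (simp add: algebra_simps)
  have "norm B = norm ((x - 1) - B * (x - 1))" using arg_cong[OF e, of norm] .
  also have "\<dots> \<le> norm (x - 1) + norm (B * (x - 1))" by (rule norm_triangle_ineq4)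
  also have "\<dots> \<le> norm (x - 1) + norm B * norm (x - 1)" by (intro add_left_mono norm_mult_ineq)
  finally have "norm B \<le> norm (x - 1) + norm B * norm (x - 1)" .
  then show False using B x1 by simp
qed

lemma selfadjoint_norm_not_cunit:
  fixes b :: "'a::unital_cstar_algebra"
  assumes "b\<^sup>\<star> = b" "norm b > 0" "cunit (norm b *\<^sub>R 1 - b)" "cunit (norm b *\<^sub>R 1 + b)"
  shows False
proof (rule selfadjoint_norm_one_not_cunit)
  let ?c = "inverse (norm b) *\<^sub>R b"
  show "?c\<^sup>\<star> = ?c" "norm ?c = 1" using assms by auto
  show "cunit (1 - ?c)" using cunit_scaleR[OF assms(3), of "inverse (norm b)"] assms(2)
    by (simp add: algebra_simps)
  show "cunit (1 + ?c)" using cunit_scaleR[OF assms(4), of "inverse (norm b)"] assms(2)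
    by (simp add: algebra_simps)
qed

subsection \<open>Positive elements\<close>

text \<open>A self-adjoint element has no non-real spectrum, so only the negative reals
  \<open>- t\<close> are left to exclude.\<close>

lemma cstar_positive_iff:
  fixes a :: "'a::unital_cstar_algebra"
  shows "cstar_positive a \<longleftrightarrow> a\<^sup>\<star> = a \<and> (\<forall>t>0. cunit (a + t *\<^sub>R 1))"
proof -
  have sp: "cstar_spectrum a = {z. \<not> cunit (a - z *\<^sub>C 1)}"
    by (simp add: cstar_spectrum_def cunit_def inverse_pair_def)
  have neg: "complex_of_real (- t) *\<^sub>C 1 = - (t *\<^sub>R (1::'a))" for t
    by (simp only: scaleC_of_real scaleR_minus_left)
  show ?thesis
  proof (intro iffI conjI allI impI)
    assume a: "cstar_positive a"
    then show "a\<^sup>\<star> = a" by (simp add: cstar_positive_def)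
    fix t :: real assume "t > 0"
    then have "complex_of_real (- t) \<notin> \<real>\<^sub>\<ge>\<^sub>0" by (simp add: complex_nonneg_Reals_iff)
    then have "cunit (a - complex_of_real (- t) *\<^sub>C 1)" using a by (auto simp: cstar_positive_def sp)
    then show "cunit (a + t *\<^sub>R 1)" unfolding neg by simp
  next
    assume a: "a\<^sup>\<star> = a \<and> (\<forall>t>0. cunit (a + t *\<^sub>R 1))"
    have "z \<in> \<real>\<^sub>\<ge>\<^sub>0" if z: "\<not> cunit (a - z *\<^sub>C 1)" for z
    proof -
      have im: "Im z = 0" using selfadjoint_spectrum_real[of a z] a z by blast
      then have ze: "z = complex_of_real (- (- Re z))" by (simp add: complex_eq_iff)
      have "Re z \<ge> 0"
      proof (rule ccontr)
        assume "\<not> Re z \<ge> 0"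
        then have "- Re z > 0" by simp
        then have "cunit (a + (- Re z) *\<^sub>R 1)" using a by blast
        moreover have "z *\<^sub>C 1 = - ((- Re z) *\<^sub>R (1::'a))" using neg[of "- Re z"] ze by simp
        ultimately show False using z by simp
      qed
      then show ?thesis using im by (simp add: complex_nonneg_Reals_iff)
    qed
    then show "cstar_positive a" using a by (auto simp: cstar_positive_def sp)
  qed
qed

text \<open>\<open>a + s\<close> is the negative of \<open>(t - a) - (s + t)\<close>, and
  \<open>s + t\<close> is larger than the norm of \<open>t - a\<close>.\<close>

lemma cstar_positive_normI:
  assumes "a\<^sup>\<star> = a" "norm (t *\<^sub>R 1 - a) \<le> t"
  shows "cstar_positive a"
  unfolding cstar_positive_iff
proof (intro conjI allI impI)
  fix s :: real assume s: "s > 0"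
  have "t \<ge> 0" by (rule order_trans[OF norm_ge_zero assms(2)])
  then have "cunit ((t *\<^sub>R 1 - a) - (s + t) *\<^sub>R 1)" using assms(2) s by (intro cunit_diff_scaleR) auto
  then have "cunit (- ((t *\<^sub>R 1 - a) - (s + t) *\<^sub>R 1))" by (rule cunit_minus)
  then show "cunit (a + s *\<^sub>R 1)" by (simp add: algebra_simps)
qed fact

text \<open>If \<open>b = t - a\<close> had norm above \<open>t\<close>, then
  \<open>norm b - b = a + (norm b - t)\<close> would be invertible by positivity of
  \<open>a\<close>, and \<open>norm b + b\<close> because \<open>norm a < norm b + t\<close>. No
  self-adjoint \<open>b\<close> allows both.\<close>

lemma cstar_positive_normD:
  assumes "cstar_positive a" "norm a \<le> t"
  shows "norm (t *\<^sub>R 1 - a) \<le> t"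
proof (rule ccontr)
  define b where "b = t *\<^sub>R 1 - a"
  assume "\<not> norm (t *\<^sub>R 1 - a) \<le> t"
  then have b: "norm b > t" by (simp add: b_def)
  have t: "t \<ge> 0" by (rule order_trans[OF norm_ge_zero assms(2)])
  have sa: "a\<^sup>\<star> = a" and u: "\<And>s. s > 0 \<Longrightarrow> cunit (a + s *\<^sub>R 1)" using assms(1) by (auto simp: cstar_positive_iff)
  have "cunit (norm b *\<^sub>R 1 - b)"
    using u[of "norm b - t"] b by (simp add: b_def[symmetric] algebra_simps) (simp add: b_def algebra_simps)
  moreover have "cunit (a - (norm b + t) *\<^sub>R 1)" using b t assms(2) by (intro cunit_diff_scaleR) auto
  then have "cunit (- (a - (norm b + t) *\<^sub>R 1))" by (rule cunit_minus)
  then have "cunit (norm b *\<^sub>R 1 + b)" by (simp add: b_def algebra_simps)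
  moreover have "b\<^sup>\<star> = b" using sa by (simp add: b_def star_diff)
  moreover have "norm b > 0" using b t by linarith
  ultimately show False using selfadjoint_norm_not_cunit by blast
qed

lemma cstar_positive_selfadjoint: "cstar_positive a \<Longrightarrow> a\<^sup>\<star> = a"
  by (simp add: cstar_positive_def)

lemma cstar_positive_add:
  assumes "cstar_positive a" "cstar_positive b"
  shows "cstar_positive (a + b)"
proof (rule cstar_positive_normI)
  show "norm ((norm a + norm b) *\<^sub>R 1 - (a + b)) \<le> norm a + norm b"
  proof -
    have "(norm a + norm b) *\<^sub>R 1 - (a + b) = (norm a *\<^sub>R 1 - a) + (norm b *\<^sub>R 1 - b)" by (simp add: algebra_simps)
    then show ?thesis
      using norm_triangle_mono[OF cstar_positive_normD[OF assms(1) order_refl] cstar_positive_normD[OF assms(2) order_refl]]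
      by (simp only:)
  qed
qed (use assms in \<open>simp add: star_add cstar_positive_selfadjoint\<close>)

lemma cstar_positive_zero [simp]: "cstar_positive 0"
  by (rule cstar_positive_normI[of _ 0]) auto

lemma cstar_positive_scaleR:
  assumes "cstar_positive a" "r \<ge> 0"
  shows "cstar_positive (r *\<^sub>R a)"
proof (rule cstar_positive_normI)
  show "norm ((r * norm a) *\<^sub>R 1 - r *\<^sub>R a) \<le> r * norm a"
  proof -
    have "(r * norm a) *\<^sub>R 1 - r *\<^sub>R a = r *\<^sub>R (norm a *\<^sub>R 1 - a)" by (simp add: algebra_simps)
    then show ?thesis using cstar_positive_normD[OF assms(1) order_refl] assms(2) by (simp add: mult_left_mono)
  qed
qed (use assms in \<open>simp add: cstar_positive_selfadjoint\<close>)

lemma cstar_positive_sum: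
  "(\<And>i. i \<in> F \<Longrightarrow> cstar_positive (x i)) \<Longrightarrow> cstar_positive (\<Sum>i\<in>F. x i)"
  by (induction F rule: infinite_finite_induct) (auto intro: cstar_positive_add)

text \<open>A convergent sequence is bounded, so one \<open>K\<close> serves as \<open>t\<close> in
  the norm criterion for all terms, and the criterion is a closed condition.\<close>

lemma cstar_positive_LIMSEQ:
  fixes x :: "nat \<Rightarrow> 'a::unital_cstar_algebra"
  assumes "\<And>n. cstar_positive (x n)" "x \<longlonglongrightarrow> a"
  shows "cstar_positive a"
proof -
  have "Bseq x" using assms(2) by (simp add: convergentI convergent_imp_Bseq)
  then obtain K where K: "\<And>n. norm (x n) \<le> K" by (auto simp: Bseq_def)
  show ?thesis
  proof (rule cstar_positive_normI)
    have "(\<lambda>n. (x n)\<^sup>\<star>) \<longlonglongrightarrow> a\<^sup>\<star>" using bounded_linear.tendsto[OF bounded_linear_star assms(2)] .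
    moreover have "(\<lambda>n. (x n)\<^sup>\<star>) = x" using assms(1) by (auto simp: cstar_positive_selfadjoint)
    ultimately show "a\<^sup>\<star> = a" using assms(2) LIMSEQ_unique by metis
    have "(\<lambda>n. norm (K *\<^sub>R 1 - x n)) \<longlonglongrightarrow> norm (K *\<^sub>R 1 - a)" by (intro tendsto_intros assms(2))
    then show "norm (K *\<^sub>R 1 - a) \<le> K"
      by (rule LIMSEQ_le_const2) (use cstar_positive_normD[OF assms(1) K] in auto)
  qed
qed

lemma cstar_positive_norm_diff: "a\<^sup>\<star> = a \<Longrightarrow> norm a \<le> r \<Longrightarrow> cstar_positive (r *\<^sub>R 1 - a)"
  by (rule cstar_positive_normI[of _ r]) (auto simp: star_diff)

text \<open>Otherwise \<open>norm a - a\<close> is the sum of the positive elements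
  \<open>norm b - b\<close> and \<open>b - a\<close> and a positive scalar, hence invertible; so is
  \<open>norm a + a\<close>.\<close>

lemma cstar_positive_norm_mono:
  assumes "cstar_positive a" "cstar_positive (b - a)"
  shows "norm a \<le> norm b"
proof (rule ccontr)
  assume "\<not> norm a \<le> norm b"
  then have n: "norm a > norm b" by simp
  have sa: "a\<^sup>\<star> = a" using assms(1) by (rule cstar_positive_selfadjoint)
  have sb: "b\<^sup>\<star> = b" using cstar_positive_selfadjoint[OF cstar_positive_add[OF assms]] by simp
  have "cstar_positive ((norm b *\<^sub>R 1 - b) + (b - a))"
    by (intro cstar_positive_add assms cstar_positive_norm_diff sb order_refl)
  then have "cunit (((norm b *\<^sub>R 1 - b) + (b - a)) + (norm a - norm b) *\<^sub>R 1)"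
    using n by (simp only: cstar_positive_iff)
  then have "cunit (norm a *\<^sub>R 1 - a)" by (simp add: algebra_simps)
  moreover have na: "norm a > 0" using n norm_ge_zero[of b] by linarith
  then have "cunit (norm a *\<^sub>R 1 + a)" using assms(1) by (simp add: cstar_positive_iff add.commute)
  ultimately show False using selfadjoint_norm_not_cunit[OF sa na] by blast
qed

section \<open>Positivity of the elements \<open>c\<^sup>\<star> * c\<close>\<close>

lemma cstar_positive_square:
  fixes b :: "'a::unital_cstar_algebra"
  assumes sa: "b\<^sup>\<star> = b"
  shows "cstar_positive (b * b)"
  unfolding cstar_positive_iff
proof (intro conjI allI impI)
  fix t :: real assume t: "t > 0"
  \<comment> \<open>\<open>b * b + t\<close> factors as \<open>(b - w) * (b + w)\<close>, and both
    factors are invertible because the spectrum of \<open>b\<close> is real.\<close>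
  define w where "w = Complex 0 (sqrt t)"
  have w: "w * w = complex_of_real (- t)" using t by (simp add: w_def complex_eq_iff)
  have u: "cunit (b - w *\<^sub>C 1)" "cunit (b + w *\<^sub>C 1)"
    using selfadjoint_spectrum_real[OF sa, of w] selfadjoint_spectrum_real[OF sa, of "-w"] t
    by (simp_all add: w_def[symmetric] scaleC_minus_left) (simp_all add: w_def)
  then obtain x y where xy: "(b - w *\<^sub>C 1) * x = 1" "x * (b - w *\<^sub>C 1) = 1" "(b + w *\<^sub>C 1) * y = 1" "y * (b + w *\<^sub>C 1) = 1"
    by (auto simp: cunit_def inverse_pair_def)
  have "(b - w *\<^sub>C 1) * (b + w *\<^sub>C 1) = b * b - (w * w) *\<^sub>C 1"
    by (simp add: algebra_simps mult_scaleC_left mult_scaleC_right scaleC_scaleC scaleC_diff_right)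
  also have "(w * w) *\<^sub>C (1::'a) = - (t *\<^sub>R 1)" unfolding w by (simp only: scaleC_of_real scaleR_minus_left)
  finally have e: "(b - w *\<^sub>C 1) * (b + w *\<^sub>C 1) = b * b + t *\<^sub>R 1" by simp
  have "inverse_pair ((b - w *\<^sub>C 1) * (b + w *\<^sub>C 1)) (y * x)"
    unfolding inverse_pair_def using xy by (metis mult.assoc mult_1_left)
  then show "cunit (b * b + t *\<^sub>R 1)" unfolding e by (auto simp: cunit_def)
qed (simp add: star_mult sa)

text \<open>Jacobson's trick: if \<open>z\<close> inverts \<open>1 - x * y\<close>, then
  \<open>1 + y * z * x\<close> inverts \<open>1 - y * x\<close>.\<close>

lemma cunit_one_diff_swap:
  assumes "cunit (1 - x * y)"
  shows "cunit (1 - y * x)"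
proof -
  obtain z where "(1 - x * y) * z = 1" "z * (1 - x * y) = 1" using assms by (auto simp: cunit_def inverse_pair_def)
  then have z: "x * (y * z) = z - 1" "z * x * y = z - 1" by (auto simp: algebra_simps)
  have "y * x * (1 + y * z * x) = y * (1 + x * (y * z)) * x" by (simp add: algebra_simps)
  then have 1: "y * x * (1 + y * z * x) = y * z * x" by (simp add: z)
  have "(1 + y * z * x) * (y * x) = y * (1 + z * x * y) * x" by (simp add: algebra_simps)
  then have 2: "(1 + y * z * x) * (y * x) = y * z * x" by (simp add: z)
  have "inverse_pair (1 - y * x) (1 + y * z * x)"
    unfolding inverse_pair_def left_diff_distrib right_diff_distrib 1 2 by simp
  then show ?thesis by (auto simp: cunit_def)
qed

text \<open>\<open>v\<^sup>\<star> * v\<close> and \<open>v * v\<^sup>\<star>\<close> have the same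
  nonzero spectrum, and only points \<open>r + t > 0\<close> have to be tested.\<close>

lemma cstar_positive_swap:
  assumes "cstar_positive (r *\<^sub>R 1 - v\<^sup>\<star> * v)" "r \<ge> 0"
  shows "cstar_positive (r *\<^sub>R 1 - v * v\<^sup>\<star>)"
  unfolding cstar_positive_iff
proof (intro conjI allI impI)
  fix t :: real assume t: "t > 0"
  define s where "s = r + t"
  have s: "s > 0" using t assms by (simp add: s_def)
  have "cunit (r *\<^sub>R 1 - v\<^sup>\<star> * v + t *\<^sub>R 1)" using assms t by (simp add: cstar_positive_iff)
  then have "cunit (s *\<^sub>R 1 - v\<^sup>\<star> * v)" by (simp add: s_def algebra_simps)
  then have "cunit (inverse s *\<^sub>R (s *\<^sub>R 1 - v\<^sup>\<star> * v))" using s by (intro cunit_scaleR) auto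
  then have "cunit (1 - (inverse s *\<^sub>R v\<^sup>\<star>) * v)" using s by (simp add: algebra_simps)
  then have "cunit (1 - v * (inverse s *\<^sub>R v\<^sup>\<star>))" by (rule cunit_one_diff_swap)
  then have "cunit (s *\<^sub>R (1 - v * (inverse s *\<^sub>R v\<^sup>\<star>)))" using s by (intro cunit_scaleR) auto
  then have "cunit (s *\<^sub>R 1 - v * v\<^sup>\<star>)" using s by (simp add: scaleR_diff_right)
  then show "cunit (r *\<^sub>R 1 - v * v\<^sup>\<star> + t *\<^sub>R 1)" by (simp add: s_def algebra_simps)
qed (simp add: star_diff star_mult star_star)

text \<open>Twice this element is the sum of the squares of the self-adjoint elements
  \<open>v + v\<^sup>\<star>\<close> and
  \<open>\<i> *\<^sub>C (v - v\<^sup>\<star>)\<close>.\<close>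

lemma cstar_positive_star_mult_add:
  fixes v :: "'a::unital_cstar_algebra"
  shows "cstar_positive (v\<^sup>\<star> * v + v * v\<^sup>\<star>)"
proof -
  define x where "x = v + v\<^sup>\<star>"
  define y where "y = \<i> *\<^sub>C (v - v\<^sup>\<star>)"
  have "y\<^sup>\<star> = (- \<i>) *\<^sub>C (- (v - v\<^sup>\<star>))" by (simp add: y_def star_scaleC star_diff star_star)
  also have "- (v - v\<^sup>\<star>) = (-1) *\<^sub>C (v - v\<^sup>\<star>)" by (simp only: scaleC_minus_left scaleC_one)
  finally have y: "y\<^sup>\<star> = y" by (simp only: scaleC_scaleC y_def) simp
  have x: "x\<^sup>\<star> = x" by (simp add: x_def star_add star_star add.commute)
  have "y * y = (-1) *\<^sub>C ((v - v\<^sup>\<star>) * (v - v\<^sup>\<star>))" by (simp add: y_def mult_scaleC_left mult_scaleC_right scaleC_scaleC)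
  then have "y * y = - ((v - v\<^sup>\<star>) * (v - v\<^sup>\<star>))" by (simp only: scaleC_minus_left scaleC_one)
  then have "x * x + y * y = 2 *\<^sub>R (v\<^sup>\<star> * v + v * v\<^sup>\<star>)" by (simp add: x_def algebra_simps scaleR_2)
  then have "v\<^sup>\<star> * v + v * v\<^sup>\<star> = (1/2) *\<^sub>R (x * x + y * y)" by simp
  then show ?thesis
    by (simp only:) (intro cstar_positive_scaleR cstar_positive_add cstar_positive_square x y, simp)
qed


text \<open>With \<open>a = c\<^sup>\<star> c\<close>, the element \<open>v = c (t + a)\<^sup>-\<^sup>1\<close> satisfies \<open>v\<^sup>\<star> v = a (t + a)\<^sup>-\<^sup>2 \<le> 1/(4t)\<close>, hence also
  \<open>v v\<^sup>\<star> \<le> 1/(4t)\<close>, and therefore \<open>v\<^sup>\<star> v \<ge> - v v\<^sup>\<star> \<ge> - 1/(4t)\<close>. On the spectrum of \<open>a\<close> this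
  excludes an interval around \<open>-t\<close> that contains \<open>[-t, -t/2]\<close>.\<close>
lemma cunit_star_mult_shift_halve:
  fixes c :: "'a::unital_cstar_algebra"
  assumes t: "t > 0" and u: "cunit (c\<^sup>\<star> * c + t *\<^sub>R 1)" and s: "t/2 \<le> s" "s \<le> t"
  shows "cunit (c\<^sup>\<star> * c + s *\<^sub>R 1)"
proof (cases "s = t")
  case False
  with s have st: "s < t" "s > 0" using t by auto
  define a where "a = c\<^sup>\<star> * c"
  define p where "p = a + t *\<^sub>R 1"
  have sa: "a\<^sup>\<star> = a" by (simp add: a_def star_mult star_star)
  obtain d where d: "p * d = 1" "d * p = 1" using u by (auto simp: cunit_def inverse_pair_def a_def p_def)
  have sp: "p\<^sup>\<star> = p" by (simp add: p_def star_add sa)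
  have sd: "d\<^sup>\<star> = d"
    using inverse_pair_unique[of p d "d\<^sup>\<star>"] d sp by (metis inverse_pair_def star_mult star_one)
  have ap: "a = p - t *\<^sub>R 1" by (simp add: p_def)
  have ad: "a * d = 1 - t *\<^sub>R d" "d * a = 1 - t *\<^sub>R d" by (simp_all add: ap algebra_simps d)
  define v where "v = c * d"
  have vv: "v\<^sup>\<star> * v = d - t *\<^sub>R (d * d)"
  proof -
    have "v\<^sup>\<star> * v = d * (a * d)" by (simp add: v_def star_mult sd a_def mult.assoc)
    then show ?thesis by (simp add: ad algebra_simps)
  qed
  define r where "r = 1 / (4 * t)"
  have r: "r > 0" using t by (simp add: r_def)
  have "cstar_positive (r *\<^sub>R 1 - v\<^sup>\<star> * v)"
  proof -
    \<comment> \<open>Completing the square: \<open>r - (d - t * d * d)\<close> equals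
      \<open>r * w * w\<close> exactly for \<open>r = 1 / (4 * t)\<close>.\<close>
    define w where "w = 1 - (2 * t) *\<^sub>R d"
    have "w\<^sup>\<star> = w" by (simp add: w_def star_diff sd)
    then have "cstar_positive (r *\<^sub>R (w * w))" using r by (intro cstar_positive_scaleR cstar_positive_square) auto
    moreover have "w * w = 1 - (2 * t) *\<^sub>R d - (2 * t) *\<^sub>R d + (4 * t * t) *\<^sub>R (d * d)"
      by (simp add: w_def left_diff_distrib right_diff_distrib scaleR_diff_right)
    then have "r *\<^sub>R (w * w) = r *\<^sub>R 1 - (r * (2 * t)) *\<^sub>R d - (r * (2 * t)) *\<^sub>R d + (r * (4 * t * t)) *\<^sub>R (d * d)"
      by (simp add: scaleR_right_distrib scaleR_diff_right)
    moreover have "r * (2 * t) = 1/2" "r * (4 * t * t) = t" using t by (simp_all add: r_def)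
    moreover have "(1/2) *\<^sub>R d + (1/2) *\<^sub>R d = d" by (simp flip: scaleR_left_distrib)
    ultimately have "r *\<^sub>R (w * w) = r *\<^sub>R 1 - v\<^sup>\<star> * v"
      unfolding vv by (simp add: diff_diff_eq)
    with \<open>cstar_positive (r *\<^sub>R (w * w))\<close> show ?thesis by simp
  qed
  then have "cstar_positive (r *\<^sub>R 1 - v * v\<^sup>\<star>)" using r by (intro cstar_positive_swap) auto
  then have "cstar_positive ((r *\<^sub>R 1 - v * v\<^sup>\<star>) + (v\<^sup>\<star> * v + v * v\<^sup>\<star>))"
    by (intro cstar_positive_add cstar_positive_star_mult_add)
  then have pos: "cstar_positive (v\<^sup>\<star> * v + r *\<^sub>R 1)" by (simp add: algebra_simps)
  \<comment> \<open>In terms of \<open>a\<close>, the element \<open>v\<^sup>\<star> * v\<close> is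
    the function \<open>x / (t + x)^2\<close>, whose value at \<open>x = -s\<close> is
    \<open>- k\<close>. So \<open>v\<^sup>\<star> * v + k\<close> has \<open>a + s\<close> as a
    factor, and it is invertible once \<open>k > r\<close>.\<close>
  define k where "k = s / (t - s)\<^sup>2"
  have "(t - s)\<^sup>2 \<le> (t/2)\<^sup>2" using s by (intro power_mono) auto
  also have "(t/2)\<^sup>2 = t * (t / 4)" by (simp add: power2_eq_square)
  also have "\<dots> < t * (4 * s)" using s t by (intro mult_strict_left_mono) auto
  finally have "(t - s)\<^sup>2 < 4 * t * s" by simp
  then have k: "k > r" using t st by (simp add: k_def r_def field_simps)
  have "cunit ((v\<^sup>\<star> * v + r *\<^sub>R 1) + (k - r) *\<^sub>R 1)" using pos k by (simp only: cstar_positive_iff)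
  then have "cunit (v\<^sup>\<star> * v + k *\<^sub>R 1)" by (simp add: algebra_simps)
  then have "cunit ((t - s)\<^sup>2 *\<^sub>R (v\<^sup>\<star> * v + k *\<^sub>R 1))" using st by (intro cunit_scaleR) auto
  \<comment> \<open>From \<open>(t - s)^2 * x + s * (t + x)^2 = (x + s) * (s * x + t^2)\<close>,
    divided by \<open>(t + x)^2\<close>; \<open>d\<close> stands for
    \<open>1 / (t + x)\<close>.\<close>
  moreover have "(t - s)\<^sup>2 *\<^sub>R (v\<^sup>\<star> * v + k *\<^sub>R 1) = (a + s *\<^sub>R 1) * ((s *\<^sub>R 1 + (t * (t - s)) *\<^sub>R d) * d)"
  proof -
    define \<beta> where "\<beta> = t * (t - s)"
    have b: "(t - s)\<^sup>2 = \<beta> - t * s + s * s" "(t - s)\<^sup>2 * t = t * \<beta> - s * \<beta>"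
      by (simp_all add: \<beta>_def power2_eq_square algebra_simps)
    have "(a + s *\<^sub>R 1) * ((s *\<^sub>R 1 + \<beta> *\<^sub>R d) * d) =
      s *\<^sub>R (a * d) + \<beta> *\<^sub>R ((a * d) * d) + (s * s) *\<^sub>R d + (s * \<beta>) *\<^sub>R (d * d)"
      by (simp add: distrib_left distrib_right scaleR_right_distrib mult.assoc)
    also have "\<dots> = s *\<^sub>R 1 + ((\<beta> - t * s + s * s) *\<^sub>R d - (t * \<beta> - s * \<beta>) *\<^sub>R (d * d))"
      unfolding ad by (simp add: left_diff_distrib scaleR_right_diff_distrib scaleR_left_distrib
          scaleR_left_diff_distrib mult.commute)
    also have "\<dots> = s *\<^sub>R 1 + (t - s)\<^sup>2 *\<^sub>R (d - t *\<^sub>R (d * d))"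
      by (simp add: scaleR_right_diff_distrib flip: b)
    also have "\<dots> = (t - s)\<^sup>2 *\<^sub>R (v\<^sup>\<star> * v + k *\<^sub>R 1)"
      unfolding vv using st by (simp add: k_def scaleR_right_distrib)
    finally show ?thesis by (simp add: \<beta>_def)
  qed
  moreover have "(a + s *\<^sub>R 1) * ((s *\<^sub>R 1 + (t * (t - s)) *\<^sub>R d) * d) = ((s *\<^sub>R 1 + (t * (t - s)) *\<^sub>R d) * d) * (a + s *\<^sub>R 1)"
  proof -
    have "a * d = d * a" by (simp add: ad)
    then have "a * (d * d) = (d * d) * a" by (metis mult.assoc)
    with \<open>a * d = d * a\<close> show ?thesis by (simp add: algebra_simps)
  qed
  ultimately show ?thesis unfolding a_def[symmetric] by (metis cunit_mult_commD)
qed (use u in simp)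

text \<open>Start from a shift \<open>T\<close> beyond the norm, where invertibility is clear, and
  halve. The intervals from \<open>T / 2 ^ Suc m\<close> to \<open>T / 2 ^ m\<close> exhaust all
  positive shifts below \<open>T\<close>.\<close>

theorem cstar_positive_star_mult:
  fixes c :: "'a::unital_cstar_algebra"
  shows "cstar_positive (c\<^sup>\<star> * c)"
  unfolding cstar_positive_iff
proof (intro conjI allI impI)
  define a where "a = c\<^sup>\<star> * c"
  define T where "T = norm a + 1"
  have T: "T > 0" by (simp add: T_def add_nonneg_pos)
  have "cunit (a - (- T) *\<^sub>R 1)" by (rule cunit_diff_scaleR) (use T in \<open>simp add: T_def\<close>)
  then have 0: "cunit (a + T *\<^sub>R 1)" by simp
  have halve: "cunit (a + (T / 2 ^ n) *\<^sub>R 1)" for n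
  proof (induction n)
    case (Suc n)
    show ?case unfolding a_def
      by (rule cunit_star_mult_shift_halve[of "T / 2 ^ n"]) (use Suc T in \<open>auto simp: a_def divide_simps\<close>)
  qed (use 0 in simp)
  fix t :: real assume t: "t > 0"
  show "cunit (a + t *\<^sub>R 1)"
  proof (cases "t > norm a")
    case True
    then have "cunit (a - (- t) *\<^sub>R 1)" by (intro cunit_diff_scaleR) auto
    then show ?thesis by simp
  next
    case False
    then have tT: "t < T" by (simp add: T_def)
    have "(\<lambda>n. T * (1/2) ^ n) \<longlonglongrightarrow> T * 0" by (intro tendsto_mult tendsto_const LIMSEQ_power_zero) auto
    then have "\<forall>\<^sub>F n in sequentially. T * (1/2) ^ n < t" using t by (intro order_tendstoD) auto
    then have ex: "\<exists>n. T / 2 ^ n < t" by (auto simp: eventually_sequentially power_divide)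
    define n where "n = (LEAST n. T / 2 ^ n < t)"
    have n: "T / 2 ^ n < t" unfolding n_def using ex by (rule LeastI_ex)
    then have "n \<noteq> 0" using tT by (cases n) auto
    then obtain m where m: "n = Suc m" by (cases n) auto
    have "\<not> T / 2 ^ m < t" using not_less_Least[of m "\<lambda>n. T / 2 ^ n < t"] m by (simp add: n_def)
    moreover have "T / 2 ^ m / 2 < t" using n m by (simp add: mult.commute)
    ultimately show ?thesis unfolding a_def
      using cunit_star_mult_shift_halve[OF _ halve[of m, unfolded a_def], of t] T by simp
  qed
qed (simp add: star_mult star_star)

corollary cstar_positive_mult_star: "cstar_positive (c * c\<^sup>\<star>)"
  using cstar_positive_star_mult[of "c\<^sup>\<star>"] by (simp add: star_star)

subsection \<open>The module of square summable sequences\<close>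

lemma cauchy_schwarz_sum:
  fixes x y :: "'i \<Rightarrow> 'a::unital_cstar_algebra"
  shows "(norm (\<Sum>i\<in>F. x i * (y i)\<^sup>\<star>))\<^sup>2 \<le> norm (\<Sum>i\<in>F. x i * (x i)\<^sup>\<star>) * norm (\<Sum>i\<in>F. y i * (y i)\<^sup>\<star>)"
proof -
  define X where "X = (\<Sum>i\<in>F. x i * (x i)\<^sup>\<star>)"
  define Y where "Y = (\<Sum>i\<in>F. y i * (y i)\<^sup>\<star>)"
  define a where "a = (\<Sum>i\<in>F. x i * (y i)\<^sup>\<star>)"
  \<comment> \<open>Norms are taken of \<open>\<langle>x - s a y, x - s a y\<rangle> \<ge> 0\<close> before estimating \<open>a Y a\<^sup>\<star>\<close>, so that no square
    root of the positive element \<open>N - Y\<close> is needed.\<close>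
  have bound: "(norm a)\<^sup>2 \<le> N * norm X" if N: "N > norm Y" for N
  proof -
    have N0: "N > 0" using N norm_ge_zero[of Y] by linarith
    \<comment> \<open>With \<open>s * N = 1\<close> the quadratic term in \<open>s\<close> is at
      most \<open>s * (norm a)\<^sup>2\<close> and cancels half of the linear term.\<close>
    define s where "s = 1 / N"
    have s: "s > 0" "s * N = 1" using N0 by (auto simp: s_def)
    have as: "a\<^sup>\<star> = (\<Sum>i\<in>F. y i * (x i)\<^sup>\<star>)" by (simp add: a_def star_sum star_mult star_star)
    have "cstar_positive (\<Sum>i\<in>F. (x i - s *\<^sub>R (a * y i)) * (x i - s *\<^sub>R (a * y i))\<^sup>\<star>)"
      by (intro cstar_positive_sum cstar_positive_mult_star)
    also have "(\<Sum>i\<in>F. (x i - s *\<^sub>R (a * y i)) * (x i - s *\<^sub>R (a * y i))\<^sup>\<star>) =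
        (\<Sum>i\<in>F. x i * (x i)\<^sup>\<star> - s *\<^sub>R (x i * (y i)\<^sup>\<star> * a\<^sup>\<star>) - s *\<^sub>R (a * (y i * (x i)\<^sup>\<star>))
             + (s * s) *\<^sub>R (a * (y i * (y i)\<^sup>\<star>) * a\<^sup>\<star>))"
      by (intro sum.cong refl) (simp add: star_diff star_mult algebra_simps)
    also have "\<dots> = X - s *\<^sub>R (a * a\<^sup>\<star>) - s *\<^sub>R (a * a\<^sup>\<star>) + (s * s) *\<^sub>R (a * Y * a\<^sup>\<star>)"
      unfolding sum.distrib sum_subtractf X_def Y_def
      by (simp add: scaleR_sum_right[symmetric] sum_distrib_left[symmetric] sum_distrib_right[symmetric] as[symmetric])
         (simp add: a_def[symmetric])
    also have "\<dots> = (X + (s * s) *\<^sub>R (a * Y * a\<^sup>\<star>)) - (2 * s) *\<^sub>R (a * a\<^sup>\<star>)"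
      using scaleR_left_distrib[of s s "a * a\<^sup>\<star>"] by simp
    finally have "norm ((2 * s) *\<^sub>R (a * a\<^sup>\<star>)) \<le> norm (X + (s * s) *\<^sub>R (a * Y * a\<^sup>\<star>))"
      using s by (intro cstar_positive_norm_mono cstar_positive_scaleR cstar_positive_mult_star) auto
    then have "2 * s * (norm a)\<^sup>2 \<le> norm (X + (s * s) *\<^sub>R (a * Y * a\<^sup>\<star>))" using s by (simp add: norm_mult_star)
    also have "\<dots> \<le> norm X + (s * s) * norm (a * Y * a\<^sup>\<star>)"
      by (rule order_trans[OF norm_triangle_ineq]) simp
    also have "norm (a * Y * a\<^sup>\<star>) \<le> norm (a * Y) * norm (a\<^sup>\<star>)" by (rule norm_mult_ineq)
    also have "\<dots> \<le> (norm a * norm Y) * norm (a\<^sup>\<star>)" by (intro mult_right_mono norm_mult_ineq) simp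
    also have "\<dots> \<le> (norm a * N) * norm a" using N by (simp add: mult_left_mono mult_right_mono)
    finally have "2 * s * (norm a)\<^sup>2 \<le> norm X + (s * s) * ((norm a * N) * norm a)"
      using s by (simp add: mult_left_mono)
    also have "(s * s) * ((norm a * N) * norm a) = (s * N) * s * (norm a)\<^sup>2" by (simp add: power2_eq_square)
    finally have "s * (norm a)\<^sup>2 \<le> norm X" unfolding s(2) by simp
    then show ?thesis using N0 by (simp add: s_def field_simps)
  qed
  \<comment> \<open>\<open>N\<close> stays strictly above \<open>norm Y\<close> so that
    \<open>1 / N\<close> makes sense even for \<open>Y = 0\<close>; now \<open>N\<close> decreases
    to \<open>norm Y\<close>.\<close>
  have lim: "((\<lambda>N. N * norm X) \<longlongrightarrow> norm Y * norm X) (at_right (norm Y))" by (intro tendsto_intros)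
  have "(norm a)\<^sup>2 \<le> norm Y * norm X"
  proof (rule tendsto_lowerbound[OF lim])
    show "\<forall>\<^sub>F N in at_right (norm Y). (norm a)\<^sup>2 \<le> N * norm X"
      using eventually_at_right_less by (rule eventually_mono) (rule bound)
  qed simp
  then show ?thesis by (simp add: X_def Y_def a_def mult.commute)
qed

lemma l2_moduleI_Cauchy:
  assumes "\<And>e. e > 0 \<Longrightarrow> \<exists>N. \<forall>m\<ge>N. \<forall>n. norm (\<Sum>i\<in>{m..<n}. x i * (x i)\<^sup>\<star>) < e"
  shows "x \<in> l2_module"
  using assms unfolding l2_module_def summable_Cauchy by blast

lemma l2_moduleD_Cauchy:
  assumes "x \<in> l2_module" "e > 0"
  obtains N where "\<And>m n. m \<ge> N \<Longrightarrow> norm (\<Sum>i\<in>{m..<n}. x i * (x i)\<^sup>\<star>) < e"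
  using assms unfolding l2_module_def summable_Cauchy by blast

text \<open>Cauchy-Schwarz on blocks far out bounds the mixed sums by the two Cauchy tails.\<close>

lemma l2_summable:
  assumes "x \<in> l2_module" "y \<in> l2_module"
  shows "summable (\<lambda>i. x i * (y i)\<^sup>\<star>)"
  unfolding summable_Cauchy
proof (intro allI impI)
  fix e :: real assume e: "e > 0"
  obtain M where M: "\<And>m n. m \<ge> M \<Longrightarrow> norm (\<Sum>i\<in>{m..<n}. x i * (x i)\<^sup>\<star>) < e"
    using l2_moduleD_Cauchy[OF assms(1) e] by blast
  obtain N where N: "\<And>m n. m \<ge> N \<Longrightarrow> norm (\<Sum>i\<in>{m..<n}. y i * (y i)\<^sup>\<star>) < e"
    using l2_moduleD_Cauchy[OF assms(2) e] by blast
  have "norm (\<Sum>i\<in>{m..<n}. x i * (y i)\<^sup>\<star>) < e" if "m \<ge> max M N" for m n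
  proof -
    have "(norm (\<Sum>i\<in>{m..<n}. x i * (y i)\<^sup>\<star>))\<^sup>2
        \<le> norm (\<Sum>i\<in>{m..<n}. x i * (x i)\<^sup>\<star>) * norm (\<Sum>i\<in>{m..<n}. y i * (y i)\<^sup>\<star>)"
      by (rule cauchy_schwarz_sum)
    also have "\<dots> < e * e" using that M N e by (intro mult_strict_mono) auto
    finally show ?thesis using e by (simp add: power2_eq_square[symmetric] power_less_imp_less_base)
  qed
  then show "\<exists>N. \<forall>m\<ge>N. \<forall>n. norm (\<Sum>i\<in>{m..<n}. x i * (y i)\<^sup>\<star>) < e" by blast
qed

text \<open>The element is \<open>(x - y) * (x - y)\<^sup>\<star>\<close>. It lets sums of squares
  dominate the square of a sum, so \<open>l2_module\<close> is closed under addition.\<close>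

lemma cstar_positive_parallelogram:
  fixes x y :: "'a::unital_cstar_algebra"
  shows "cstar_positive (2 *\<^sub>R (x * x\<^sup>\<star>) + 2 *\<^sub>R (y * y\<^sup>\<star>) - (x + y) * (x + y)\<^sup>\<star>)"
proof -
  have "2 *\<^sub>R (x * x\<^sup>\<star>) + 2 *\<^sub>R (y * y\<^sup>\<star>) - (x + y) * (x + y)\<^sup>\<star> = (x - y) * (x - y)\<^sup>\<star>"
    by (simp add: algebra_simps star_add star_diff scaleR_2)
  then show ?thesis by (simp add: cstar_positive_mult_star)
qed

lemma l2_add:
  assumes "x \<in> l2_module" "y \<in> l2_module"
  shows "(\<lambda>i. x i + y i) \<in> l2_module"
proof (rule l2_moduleI_Cauchy)
  fix e :: real assume e: "e > 0"
  then have e4: "e/4 > 0" by simp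
  obtain M where M: "\<And>m n. m \<ge> M \<Longrightarrow> norm (\<Sum>i\<in>{m..<n}. x i * (x i)\<^sup>\<star>) < e/4"
    using l2_moduleD_Cauchy[OF assms(1) e4] by blast
  obtain N where N: "\<And>m n. m \<ge> N \<Longrightarrow> norm (\<Sum>i\<in>{m..<n}. y i * (y i)\<^sup>\<star>) < e/4"
    using l2_moduleD_Cauchy[OF assms(2) e4] by blast
  have "norm (\<Sum>i\<in>{m..<n}. (x i + y i) * (x i + y i)\<^sup>\<star>) < e" if m: "m \<ge> max M N" for m n
  proof -
    let ?X = "\<Sum>i\<in>{m..<n}. x i * (x i)\<^sup>\<star>" and ?Y = "\<Sum>i\<in>{m..<n}. y i * (y i)\<^sup>\<star>"
    have "cstar_positive (\<Sum>i\<in>{m..<n}. 2 *\<^sub>R (x i * (x i)\<^sup>\<star>) + 2 *\<^sub>R (y i * (y i)\<^sup>\<star>) - (x i + y i) * (x i + y i)\<^sup>\<star>)"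
      by (intro cstar_positive_sum cstar_positive_parallelogram)
    then have "cstar_positive ((2 *\<^sub>R ?X + 2 *\<^sub>R ?Y) - (\<Sum>i\<in>{m..<n}. (x i + y i) * (x i + y i)\<^sup>\<star>))"
      by (simp add: sum.distrib sum_subtractf scaleR_sum_right)
    then have "norm (\<Sum>i\<in>{m..<n}. (x i + y i) * (x i + y i)\<^sup>\<star>) \<le> norm (2 *\<^sub>R ?X + 2 *\<^sub>R ?Y)"
      by (intro cstar_positive_norm_mono cstar_positive_sum cstar_positive_mult_star)
    also have "\<dots> \<le> 2 * norm ?X + 2 * norm ?Y" by (rule order_trans[OF norm_triangle_ineq]) simp
    also have "\<dots> < e" using M[of m n] N[of m n] m by simp
    finally show ?thesis .
  qed
  then show "\<exists>N. \<forall>m\<ge>N. \<forall>n. norm (\<Sum>i\<in>{m..<n}. (x i + y i) * (x i + y i)\<^sup>\<star>) < e" by blast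
qed

lemma l2_mult_left:
  assumes "x \<in> l2_module"
  shows "(\<lambda>i. a * x i) \<in> l2_module"
proof -
  have "summable (\<lambda>i. a * (x i * (x i)\<^sup>\<star>) * a\<^sup>\<star>)"
    using assms unfolding l2_module_def by (intro summable_mult summable_mult2) auto
  then show ?thesis by (simp add: l2_module_def star_mult mult.assoc)
qed

lemma l2_scaleR: "x \<in> l2_module \<Longrightarrow> (\<lambda>i. r *\<^sub>R x i) \<in> l2_module"
  using l2_mult_left[of x "r *\<^sub>R 1"] by simp

lemma l2_diff: "x \<in> l2_module \<Longrightarrow> y \<in> l2_module \<Longrightarrow> (\<lambda>i. x i - y i) \<in> l2_module"
  using l2_add[of x "\<lambda>i. (-1) *\<^sub>R y i"] l2_scaleR[of y "-1"] by simp

lemma l2_zero [simp]: "(\<lambda>i. 0) \<in> l2_module"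
  by (simp add: l2_module_def)

lemma l2_sum:
  "(\<And>j. j \<in> F \<Longrightarrow> x j \<in> l2_module) \<Longrightarrow> (\<lambda>i. \<Sum>j\<in>F. a j * x j i) \<in> l2_module"
  by (induction F rule: infinite_finite_induct) (simp_all add: l2_add l2_mult_left)

lemma l2_inner_sums:
  "x \<in> l2_module \<Longrightarrow> y \<in> l2_module \<Longrightarrow> (\<lambda>i. x i * (y i)\<^sup>\<star>) sums l2_inner x y"
  unfolding l2_inner_def by (intro summable_sums l2_summable)

lemma star_l2_inner:
  assumes "x \<in> l2_module" "y \<in> l2_module"
  shows "(l2_inner x y)\<^sup>\<star> = l2_inner y x"
  using bounded_linear.sums[OF bounded_linear_star l2_inner_sums[OF assms]] l2_inner_sums[OF assms(2,1)]
  by (simp add: star_mult star_star sums_unique2)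

lemma l2_inner_add_left:
  assumes "x \<in> l2_module" "y \<in> l2_module" "z \<in> l2_module"
  shows "l2_inner (\<lambda>i. x i + y i) z = l2_inner x z + l2_inner y z"
  using sums_add[OF l2_inner_sums[OF assms(1,3)] l2_inner_sums[OF assms(2,3)]]
    l2_inner_sums[OF l2_add[OF assms(1,2)] assms(3)]
  by (simp add: distrib_right sums_unique2)

lemma l2_inner_mult_left:
  assumes "x \<in> l2_module" "z \<in> l2_module"
  shows "l2_inner (\<lambda>i. a * x i) z = a * l2_inner x z"
  using sums_mult[OF l2_inner_sums[OF assms], of a] l2_inner_sums[OF l2_mult_left[OF assms(1), of a] assms(2)]
  by (simp add: mult.assoc sums_unique2)

lemma l2_inner_scaleR_left:
  "x \<in> l2_module \<Longrightarrow> z \<in> l2_module \<Longrightarrow> l2_inner (\<lambda>i. r *\<^sub>R x i) z = r *\<^sub>R l2_inner x z"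
  using l2_inner_mult_left[of x z "r *\<^sub>R 1"] by simp

lemma l2_inner_diff_left:
  "x \<in> l2_module \<Longrightarrow> y \<in> l2_module \<Longrightarrow> z \<in> l2_module \<Longrightarrow>
   l2_inner (\<lambda>i. x i - y i) z = l2_inner x z - l2_inner y z"
  using l2_inner_add_left[of x "\<lambda>i. (-1) *\<^sub>R y i" z] l2_inner_scaleR_left[of y z "-1"] l2_scaleR[of y "-1"] by simp

lemma l2_inner_sum_left:
  assumes "\<And>j. j \<in> F \<Longrightarrow> x j \<in> l2_module" "z \<in> l2_module"
  shows "l2_inner (\<lambda>i. \<Sum>j\<in>F. a j * x j i) z = (\<Sum>j\<in>F. a j * l2_inner (x j) z)"
  using assms(1)
proof (induction F rule: infinite_finite_induct)
  case (insert j F)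
  then show ?case using l2_inner_add_left[of "\<lambda>i. a j * x j i" "\<lambda>i. \<Sum>j\<in>F. a j * x j i" z]
    assms(2) by (simp add: l2_mult_left l2_sum l2_inner_mult_left)
qed (simp_all add: l2_inner_def)

lemma l2_inner_add_right:
  assumes "x \<in> l2_module" "y \<in> l2_module" "z \<in> l2_module"
  shows "l2_inner z (\<lambda>i. x i + y i) = l2_inner z x + l2_inner z y"
  using assms by (simp flip: star_l2_inner[of _ z] add: l2_inner_add_left l2_add star_add)

lemma l2_inner_diff_right:
  assumes "x \<in> l2_module" "y \<in> l2_module" "z \<in> l2_module"
  shows "l2_inner z (\<lambda>i. x i - y i) = l2_inner z x - l2_inner z y"
  using assms by (simp flip: star_l2_inner[of _ z] add: l2_inner_diff_left l2_diff star_diff)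

lemma l2_inner_scaleR_right:
  assumes "x \<in> l2_module" "z \<in> l2_module"
  shows "l2_inner z (\<lambda>i. r *\<^sub>R x i) = r *\<^sub>R l2_inner z x"
  using assms by (simp flip: star_l2_inner[of _ z] add: l2_inner_scaleR_left l2_scaleR)

lemma cstar_positive_l2_inner:
  assumes "x \<in> l2_module"
  shows "cstar_positive (l2_inner x x)"
  using l2_inner_sums[OF assms assms] unfolding sums_def
  by (rule cstar_positive_LIMSEQ[rotated]) (intro cstar_positive_sum cstar_positive_mult_star)

lemma l2_norm_nonneg [simp]: "l2_norm x \<ge> 0"
  by (simp add: l2_norm_def)

lemma l2_norm_power2: "(l2_norm x)\<^sup>2 = norm (l2_inner x x)"
  by (simp add: l2_norm_def)

lemma l2_norm_zero [simp]: "l2_norm (\<lambda>i. 0) = 0"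
  by (simp add: l2_norm_def l2_inner_def)

lemma norm_l2_inner_le:
  assumes "x \<in> l2_module" "y \<in> l2_module"
  shows "norm (l2_inner x y) \<le> l2_norm x * l2_norm y"
proof -
  have lim: "(\<lambda>n. (\<Sum>i<n. x i * (y i)\<^sup>\<star>)) \<longlonglongrightarrow> l2_inner x y"
    if "x \<in> l2_module" "y \<in> l2_module" for x y :: "nat \<Rightarrow> 'a"
    using l2_inner_sums[OF that] by (simp add: sums_def)
  have "(norm (l2_inner x y))\<^sup>2 \<le> norm (l2_inner x x) * norm (l2_inner y y)"
    by (rule LIMSEQ_le[OF tendsto_power[OF tendsto_norm[OF lim[OF assms]]]
          tendsto_mult[OF tendsto_norm[OF lim[OF assms(1,1)]] tendsto_norm[OF lim[OF assms(2,2)]]]])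
       (auto simp: cauchy_schwarz_sum)
  then have "(norm (l2_inner x y))\<^sup>2 \<le> (l2_norm x * l2_norm y)\<^sup>2"
    by (simp add: power_mult_distrib l2_norm_power2)
  then show ?thesis by (rule power2_le_imp_le) simp
qed

lemma l2_norm_add_le:
  assumes "x \<in> l2_module" "y \<in> l2_module"
  shows "l2_norm (\<lambda>i. x i + y i) \<le> l2_norm x + l2_norm y"
proof (rule power2_le_imp_le)
  have "(l2_norm (\<lambda>i. x i + y i))\<^sup>2 = norm ((l2_inner x x + l2_inner x y) + (l2_inner y x + l2_inner y y))"
    using assms by (simp add: l2_norm_power2 l2_inner_add_left l2_inner_add_right l2_add algebra_simps)
  also have "\<dots> \<le> (norm (l2_inner x x) + norm (l2_inner x y)) + (norm (l2_inner y x) + norm (l2_inner y y))"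
    by (intro norm_triangle_mono norm_triangle_ineq)
  also have "\<dots> \<le> (l2_norm x + l2_norm y)\<^sup>2"
    using norm_l2_inner_le[OF assms] norm_l2_inner_le[OF assms(2,1)]
    unfolding power2_sum l2_norm_power2[symmetric] by (simp only: mult.commute[of "l2_norm y"])
  finally show "(l2_norm (\<lambda>i. x i + y i))\<^sup>2 \<le> (l2_norm x + l2_norm y)\<^sup>2" .
qed simp

lemma l2_norm_scaleR:
  assumes "x \<in> l2_module"
  shows "l2_norm (\<lambda>i. r *\<^sub>R x i) = \<bar>r\<bar> * l2_norm x"
  unfolding l2_norm_def using assms
  by (simp add: l2_inner_scaleR_left l2_inner_scaleR_right l2_scaleR real_sqrt_mult mult.assoc[symmetric])

section \<open>Finite truncations\<close>

definition truncate :: "nat set \<Rightarrow> (nat \<Rightarrow> 'a::unital_cstar_algebra) \<Rightarrow> nat \<Rightarrow> 'a" where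
  "truncate F x = (\<lambda>i. if i \<in> F then x i else 0)"

lemma truncate_sums:
  assumes "finite F"
  shows "(\<lambda>i. truncate F x i * (truncate F x i)\<^sup>\<star>) sums (\<Sum>i\<in>F. x i * (x i)\<^sup>\<star>)"
proof -
  have "(\<lambda>i. if i \<in> F then x i * (x i)\<^sup>\<star> else 0) sums (\<Sum>i\<in>F. x i * (x i)\<^sup>\<star>)"
    by (rule sums_If_finite_set[OF assms])
  also have "(\<lambda>i. if i \<in> F then x i * (x i)\<^sup>\<star> else 0) = (\<lambda>i. truncate F x i * (truncate F x i)\<^sup>\<star>)"
    by (auto simp: truncate_def)
  finally show ?thesis .
qed

text \<open>\<open>x\<close> is arbitrary, so coefficient families outside \<open>l2_module\<close>
  can also be measured on finite index sets.\<close>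

lemma truncate_l2: "finite F \<Longrightarrow> truncate F x \<in> l2_module"
  using truncate_sums[of F x] by (auto simp: l2_module_def sums_iff)

lemma l2_norm_truncate:
  "finite F \<Longrightarrow> (l2_norm (truncate F x))\<^sup>2 = norm (\<Sum>i\<in>F. x i * (x i)\<^sup>\<star>)"
  using truncate_sums[of F x] by (simp add: l2_norm_power2 l2_inner_def sums_iff)

text \<open>Pythagoras: a truncation and its remainder have disjoint supports, so there are no cross
  terms.\<close>

lemma l2_inner_diff_truncate:
  assumes "x \<in> l2_module" "finite F"
  shows "l2_inner (\<lambda>i. x i - truncate F x i) (\<lambda>i. x i - truncate F x i) = l2_inner x x - (\<Sum>i\<in>F. x i * (x i)\<^sup>\<star>)"
proof -
  have "(\<lambda>i. x i * (x i)\<^sup>\<star> - truncate F x i * (truncate F x i)\<^sup>\<star>) =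
        (\<lambda>i. (x i - truncate F x i) * (x i - truncate F x i)\<^sup>\<star>)"
    by (auto simp: truncate_def)
  then show ?thesis
    using sums_diff[OF l2_inner_sums[OF assms(1,1)] truncate_sums[OF assms(2), of x]]
    by (simp add: l2_inner_def sums_iff)
qed

lemma norm_sum_le_l2_norm:
  assumes "x \<in> l2_module" "finite F"
  shows "norm (\<Sum>i\<in>F. x i * (x i)\<^sup>\<star>) \<le> (l2_norm x)\<^sup>2"
proof -
  have "cstar_positive (l2_inner x x - (\<Sum>i\<in>F. x i * (x i)\<^sup>\<star>))"
    unfolding l2_inner_diff_truncate[OF assms, symmetric]
    by (intro cstar_positive_l2_inner l2_diff truncate_l2 assms)
  then show ?thesis unfolding l2_norm_power2
    by (intro cstar_positive_norm_mono cstar_positive_sum cstar_positive_mult_star)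
qed

lemma l2_norm_truncate_le:
  "x \<in> l2_module \<Longrightarrow> finite F \<Longrightarrow> l2_norm (truncate F x) \<le> l2_norm x"
  by (rule power2_le_imp_le) (simp_all add: l2_norm_truncate norm_sum_le_l2_norm)

lemma norm_coordinate_le:
  assumes "x \<in> l2_module"
  shows "norm (x i) \<le> l2_norm x"
  using norm_sum_le_l2_norm[OF assms, of "{i}"] by (auto simp: norm_mult_star intro: power2_le_imp_le)

lemma truncate_dense:
  assumes "x \<in> l2_module" "e > 0"
  obtains n where "l2_norm (\<lambda>i. x i - truncate {..<n} x i) < e"
proof -
  have "(\<lambda>n. norm (l2_inner x x - (\<Sum>i<n. x i * (x i)\<^sup>\<star>))) \<longlonglongrightarrow> norm (l2_inner x x - l2_inner x x)"
    using l2_inner_sums[OF assms(1,1)] unfolding sums_def by (intro tendsto_intros)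
  then have "\<forall>\<^sub>F n in sequentially. norm (l2_inner x x - (\<Sum>i<n. x i * (x i)\<^sup>\<star>)) < e\<^sup>2"
    using assms(2) by (intro order_tendstoD) auto
  then obtain n where "norm (l2_inner x x - (\<Sum>i<n. x i * (x i)\<^sup>\<star>)) < e\<^sup>2" by (auto simp: eventually_sequentially)
  then have "(l2_norm (\<lambda>i. x i - truncate {..<n} x i))\<^sup>2 < e\<^sup>2"
    using l2_inner_diff_truncate[OF assms(1), of "{..<n}"] by (simp add: l2_norm_power2)
  then show ?thesis using that assms(2) power_less_imp_less_base by (metis less_eq_real_def)
qed

section \<open>The standard orthonormal basis\<close>

definition std_basis :: "nat \<Rightarrow> nat \<Rightarrow> 'a::unital_cstar_algebra" where
  "std_basis j i = (if i = j then 1 else 0)"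

lemma std_basis_l2: "(std_basis j :: nat \<Rightarrow> 'a::unital_cstar_algebra) \<in> l2_module"
proof -
  have "(std_basis j :: nat \<Rightarrow> 'a) = truncate {j} (\<lambda>i. 1)" by (auto simp: std_basis_def truncate_def)
  then show ?thesis by (simp add: truncate_l2)
qed

lemma l2_inner_std_basis: "l2_inner y (std_basis j) = y j"
proof -
  have "(\<lambda>i. y i * (std_basis j i)\<^sup>\<star>) = (\<lambda>i. if i = j then y i else 0)" by (auto simp: std_basis_def)
  then show ?thesis using sums_single[of j y] by (simp add: l2_inner_def sums_iff)
qed

lemma sum_std_basis: "finite F \<Longrightarrow> (\<Sum>j\<in>F. a j * std_basis j i) = truncate F a i"
  by (simp add: std_basis_def truncate_def if_distrib cong: if_cong)

lemma orthonormal_basis_std_basis: "orthonormal_basis std_basis"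
  unfolding orthonormal_basis_def generating_def
proof (intro conjI allI ballI impI)
  fix y :: "nat \<Rightarrow> 'a" and e :: real assume "y \<in> l2_module" "e > 0"
  then obtain n where n: "l2_norm (\<lambda>i. y i - truncate {..<n} y i) < e" using truncate_dense by blast
  show "\<exists>F a. finite F \<and> l2_norm (\<lambda>i. y i - (\<Sum>j\<in>F. a j * std_basis j i)) < e"
    by (rule exI[of _ "{..<n}"], rule exI[of _ y]) (simp add: sum_std_basis n)
qed (simp_all add: std_basis_l2 l2_inner_std_basis, simp add: std_basis_def)

subsection \<open>Bessel sequences and the perturbed basis\<close>

text \<open>Membership of the coefficients in \<open>l2_module\<close> encodes convergence of the
  frame sum. The bound stays in the order of A because the frame inequalities to be derived from it
  live there.\<close>

definition bessel :: "(nat \<Rightarrow> nat \<Rightarrow> 'a::unital_cstar_algebra) \<Rightarrow> real \<Rightarrow> bool" where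
  "bessel f D \<longleftrightarrow> (\<forall>j. f j \<in> l2_module) \<and> (\<forall>y\<in>l2_module. (\<lambda>j. l2_inner y (f j)) \<in> l2_module \<and>
     cstar_positive (D *\<^sub>R l2_inner y y - l2_inner (\<lambda>j. l2_inner y (f j)) (\<lambda>j. l2_inner y (f j))))"

lemma standard_frame_bessel:
  assumes "standard_frame f"
  obtains D where "D > 0" "bessel f D"
proof -
  have f: "\<And>j. f j \<in> l2_module" using assms by (auto simp: standard_frame_def)
  have st: "l2_inner (f j) y = (l2_inner y (f j))\<^sup>\<star>" if "y \<in> l2_module" for y j
    using star_l2_inner[OF that f] by simp
  obtain D where D: "D > 0" "\<And>y. y \<in> l2_module \<Longrightarrow>
      (\<Sum>j. l2_inner y (f j) * l2_inner (f j) y) \<sqsubseteq> D *\<^sub>R l2_inner y y"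
    using assms unfolding standard_frame_def by blast
  have "bessel f D"
    unfolding bessel_def
  proof (intro conjI allI ballI f)
    fix y :: "nat \<Rightarrow> 'a" assume y: "y \<in> l2_module"
    have "summable (\<lambda>j. l2_inner y (f j) * l2_inner (f j) y)" using assms y unfolding standard_frame_def by blast
    then show "(\<lambda>j. l2_inner y (f j)) \<in> l2_module" by (simp add: l2_module_def st[OF y])
    show "cstar_positive (D *\<^sub>R l2_inner y y - l2_inner (\<lambda>j. l2_inner y (f j)) (\<lambda>j. l2_inner y (f j)))"
      using D(2)[OF y] unfolding cstar_le_def st[OF y] by (simp add: l2_inner_def[of "\<lambda>j. l2_inner y (f j)"])
  qed
  then show ?thesis using D(1) that by blast
qed

text \<open>An operator and its adjoint have the same norm: expand \<open>l2_inner x x\<close> along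
  the combination and apply Cauchy-Schwarz to \<open>a\<close> and the analysis coefficients
  \<open>T\<close>. This gives \<open>L * L\<close> at most \<open>D * L\<close> times the squared
  norm of \<open>a\<close>, and one \<open>L\<close> cancels.\<close>

lemma bessel_synthesis_norm:
  fixes f :: "nat \<Rightarrow> nat \<Rightarrow> 'a::unital_cstar_algebra"
  assumes b: "bessel f D" and D: "D \<ge> 0" and F: "finite F"
  shows "l2_norm (\<lambda>i. \<Sum>j\<in>F. a j * f j i) \<le> sqrt D * l2_norm (truncate F a)"
proof (rule power2_le_imp_le)
  define x where "x = (\<lambda>i. \<Sum>j\<in>F. a j * f j i)"
  define T where "T j = l2_inner x (f j)" for j
  define L where "L = (l2_norm x)\<^sup>2"
  have f: "\<And>j. f j \<in> l2_module" using b by (simp add: bessel_def)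
  have x: "x \<in> l2_module" unfolding x_def by (intro l2_sum f)
  have T: "T \<in> l2_module" and pos: "cstar_positive (D *\<^sub>R l2_inner x x - l2_inner T T)"
    using b x unfolding bessel_def T_def by auto
  have "norm (l2_inner T T) \<le> norm (D *\<^sub>R l2_inner x x)"
    by (intro cstar_positive_norm_mono pos cstar_positive_l2_inner T)
  then have TD: "(l2_norm T)\<^sup>2 \<le> D * L" using D by (simp add: L_def l2_norm_power2)
  have "l2_inner x x = (\<Sum>j\<in>F. a j * l2_inner (f j) x)"
    using l2_inner_sum_left[of F f x a] f x by (simp add: x_def)
  also have "\<dots> = (\<Sum>j\<in>F. a j * (T j)\<^sup>\<star>)" using star_l2_inner[OF x f] by (simp add: T_def)
  finally have "L\<^sup>2 = (norm (\<Sum>j\<in>F. a j * (T j)\<^sup>\<star>))\<^sup>2" by (simp add: L_def l2_norm_power2)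
  also have "\<dots> \<le> norm (\<Sum>j\<in>F. a j * (a j)\<^sup>\<star>) * norm (\<Sum>j\<in>F. T j * (T j)\<^sup>\<star>)" by (rule cauchy_schwarz_sum)
  also have "\<dots> \<le> (l2_norm (truncate F a))\<^sup>2 * (D * L)"
    using norm_sum_le_l2_norm[OF T F] TD unfolding l2_norm_truncate[OF F] by (intro mult_left_mono) auto
  finally have LL: "L * L \<le> (D * (l2_norm (truncate F a))\<^sup>2) * L" by (simp add: power2_eq_square mult_ac)
  have "L \<le> D * (l2_norm (truncate F a))\<^sup>2"
  proof (cases "L > 0")
    case True then show ?thesis using LL by simp
  next
    case False
    have "0 \<le> D * (l2_norm (truncate F a))\<^sup>2" using D by simp
    then show ?thesis using False by linarith
  qed
  then show "(l2_norm (\<lambda>i. \<Sum>j\<in>F. a j * f j i))\<^sup>2 \<le> (sqrt D * l2_norm (truncate F a))\<^sup>2"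
    using D by (simp add: L_def x_def power_mult_distrib)
qed (use D in simp)

text \<open>The image of the standard basis under \<open>r\<close> times the synthesis operator
  minus the identity; \<open>r\<close> is 1 / \<lambda>.\<close>

definition perturbed_basis :: "real \<Rightarrow> (nat \<Rightarrow> nat \<Rightarrow> 'a::unital_cstar_algebra) \<Rightarrow> nat \<Rightarrow> nat \<Rightarrow> 'a" where
  "perturbed_basis r f j i = r *\<^sub>R f j i - std_basis j i"

lemma perturbed_basis_l2:
  "f j \<in> l2_module \<Longrightarrow> perturbed_basis r f j \<in> l2_module"
  unfolding perturbed_basis_def by (intro l2_diff l2_scaleR std_basis_l2)

text \<open>The coefficients of \<open>y\<close> are \<open>u = K - y\<close>, where
  \<open>K\<close> is \<open>r\<close> times the analysis sequence of \<open>f\<close> and its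
  square \<open>KK\<close> is at most \<open>Y / 4\<close>. Parallelogram identities then compare
  \<open>U\<close> with \<open>Y\<close>.\<close>

lemma standard_frame_perturbed_basis:
  fixes f :: "nat \<Rightarrow> nat \<Rightarrow> 'a::unital_cstar_algebra"
  assumes b: "bessel f D" and r: "r * r * D = 1/4"
  shows "standard_frame (perturbed_basis r f)"
proof -
  let ?h = "perturbed_basis r f"
  have f: "\<And>j. f j \<in> l2_module" using b by (simp add: bessel_def)
  have h: "\<And>j. ?h j \<in> l2_module" by (intro perturbed_basis_l2 f)
  have key: "summable (\<lambda>j. l2_inner y (?h j) * l2_inner (?h j) y) \<and>
      (1/4) *\<^sub>R l2_inner y y \<sqsubseteq> (\<Sum>j. l2_inner y (?h j) * l2_inner (?h j) y) \<and>
      (\<Sum>j. l2_inner y (?h j) * l2_inner (?h j) y) \<sqsubseteq> (5/2) *\<^sub>R l2_inner y y"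
    if y: "y \<in> l2_module" for y
  proof -
    define T where "T = (\<lambda>j. l2_inner y (f j))"
    define K where "K = (\<lambda>j. r *\<^sub>R T j)"
    define u where "u = (\<lambda>j. K j - y j)"
    have T: "T \<in> l2_module" and pos: "cstar_positive (D *\<^sub>R l2_inner y y - l2_inner T T)"
      using b y unfolding bessel_def T_def by auto
    have K: "K \<in> l2_module" unfolding K_def by (intro l2_scaleR T)
    have u: "u \<in> l2_module" unfolding u_def by (intro l2_diff K y)
    have hu: "l2_inner y (?h j) = u j" for j
      unfolding perturbed_basis_def
      using y f[of j] by (simp add: l2_inner_diff_right l2_inner_scaleR_right l2_scaleR std_basis_l2 u_def K_def T_def l2_inner_std_basis)
    have hu': "l2_inner (?h j) y = (u j)\<^sup>\<star>" for j
      using star_l2_inner[OF y h, of j] by (simp add: hu)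
    define Y where "Y = l2_inner y y"
    define KK where "KK = l2_inner K K"
    define U where "U = l2_inner u u"
    have "cstar_positive ((2 * (r * r)) *\<^sub>R (D *\<^sub>R l2_inner y y - l2_inner T T))"
      by (intro cstar_positive_scaleR pos) simp
    then have "cstar_positive ((2 * (r * r) * D) *\<^sub>R Y - 2 *\<^sub>R ((r * r) *\<^sub>R l2_inner T T))"
      by (simp add: scaleR_diff_right Y_def)
    moreover have "KK = (r * r) *\<^sub>R l2_inner T T"
      unfolding KK_def K_def using T by (simp add: l2_inner_scaleR_left l2_inner_scaleR_right l2_scaleR)
    moreover have "2 * (r * r) * D = 1/2" using r by simp
    ultimately have pK: "cstar_positive ((1/2) *\<^sub>R Y - 2 *\<^sub>R KK)"
      by (simp only:)
    \<comment> \<open>As \<open>y = K - u\<close>, this gives \<open>Y \<le> 2 KK + 2 U\<close>, so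
      \<open>U\<close> is at least \<open>Y / 2 - KK\<close>, hence at least
      \<open>Y / 4\<close>.\<close>
    have "cstar_positive (l2_inner (\<lambda>j. K j + u j) (\<lambda>j. K j + u j))"
      by (intro cstar_positive_l2_inner l2_add K u)
    moreover have "l2_inner (\<lambda>j. K j + u j) (\<lambda>j. K j + u j) = 2 *\<^sub>R KK + 2 *\<^sub>R U - Y"
    proof -
      have "y = (\<lambda>j. K j - u j)" by (auto simp: u_def)
      then have "Y = KK - l2_inner K u - l2_inner u K + U"
        unfolding Y_def KK_def U_def using K u by (simp add: l2_inner_diff_left l2_inner_diff_right l2_diff)
      moreover have "l2_inner (\<lambda>j. K j + u j) (\<lambda>j. K j + u j) = KK + l2_inner K u + l2_inner u K + U"
        unfolding KK_def U_def using K u by (simp add: l2_inner_add_left l2_inner_add_right l2_add)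
      ultimately show ?thesis by (simp add: scaleR_2)
    qed
    ultimately have "cstar_positive ((1/2) *\<^sub>R ((2 *\<^sub>R KK + 2 *\<^sub>R U - Y) + ((1/2) *\<^sub>R Y - 2 *\<^sub>R KK)))"
      by (intro cstar_positive_scaleR cstar_positive_add pK) auto
    moreover have "(1/2) *\<^sub>R ((2 *\<^sub>R KK + 2 *\<^sub>R U - Y) + ((1/2) *\<^sub>R Y - 2 *\<^sub>R KK)) = U - (1/4) *\<^sub>R Y"
    proof -
      have "Y = (1/2) *\<^sub>R Y + (1/2) *\<^sub>R Y" by (simp flip: scaleR_left_distrib)
      then have "(2 *\<^sub>R KK + 2 *\<^sub>R U - Y) + ((1/2) *\<^sub>R Y - 2 *\<^sub>R KK) = 2 *\<^sub>R U - (1/2) *\<^sub>R Y"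
        by (simp only: diff_conv_add_uminus) (simp add: algebra_simps)
      then have "(1/2) *\<^sub>R ((2 *\<^sub>R KK + 2 *\<^sub>R U - Y) + ((1/2) *\<^sub>R Y - 2 *\<^sub>R KK)) = (1/2) *\<^sub>R (2 *\<^sub>R U - (1/2) *\<^sub>R Y)"
        by (simp only:)
      then show ?thesis by (simp add: scaleR_diff_right)
    qed
    ultimately have lower: "cstar_positive (U - (1/4) *\<^sub>R Y)" by simp
    \<comment> \<open>As \<open>u = K - y\<close>, this gives \<open>U \<le> 2 KK + 2 Y\<close>,
      which is at most \<open>5/2\<close> times \<open>Y\<close>.\<close>
    have "cstar_positive (l2_inner (\<lambda>j. K j + y j) (\<lambda>j. K j + y j))"
      by (intro cstar_positive_l2_inner l2_add K y)
    moreover have "l2_inner (\<lambda>j. K j + y j) (\<lambda>j. K j + y j) = 2 *\<^sub>R KK + 2 *\<^sub>R Y - U"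
    proof -
      have "U = KK - l2_inner K y - l2_inner y K + Y"
        unfolding Y_def KK_def U_def u_def using K y by (simp add: l2_inner_diff_left l2_inner_diff_right l2_diff)
      moreover have "l2_inner (\<lambda>j. K j + y j) (\<lambda>j. K j + y j) = KK + l2_inner K y + l2_inner y K + Y"
        unfolding KK_def Y_def using K y by (simp add: l2_inner_add_left l2_inner_add_right l2_add)
      ultimately show ?thesis by (simp add: scaleR_2)
    qed
    ultimately have "cstar_positive ((2 *\<^sub>R KK + 2 *\<^sub>R Y - U) + ((1/2) *\<^sub>R Y - 2 *\<^sub>R KK))"
      by (intro cstar_positive_add pK) auto
    moreover have "2 *\<^sub>R Y + (1/2) *\<^sub>R Y = (5/2) *\<^sub>R Y" by (simp flip: scaleR_left_distrib)
    then have "(2 *\<^sub>R KK + 2 *\<^sub>R Y - U) + ((1/2) *\<^sub>R Y - 2 *\<^sub>R KK) = (5/2) *\<^sub>R Y - U"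
      by (simp add: algebra_simps)
    ultimately have upper: "cstar_positive ((5/2) *\<^sub>R Y - U)" by simp
    have "summable (\<lambda>j. u j * (u j)\<^sup>\<star>)" using u by (simp add: l2_module_def)
    then show ?thesis using lower upper unfolding hu hu' cstar_le_def
      by (simp add: U_def Y_def l2_inner_def[of u u])
  qed
  show ?thesis unfolding standard_frame_def
    by (intro conjI allI ballI exI[of _ "1/4"] exI[of _ "5/2"] h) (use key in auto)
qed

section \<open>Finite combinations of the perturbed basis\<close>

lemma sum_perturbed_basis:
  assumes "finite F"
  shows "(\<Sum>j\<in>F. a j * perturbed_basis r f j i) = r *\<^sub>R (\<Sum>j\<in>F. a j * f j i) - truncate F a i"
  using assms by (simp add: perturbed_basis_def right_diff_distrib sum_subtractf sum_std_basis scaleR_sum_right)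

text \<open>Adding the identity back leaves \<open>r\<close> times the synthesis operator of
  \<open>f\<close>, of norm at most \<open>r * sqrt D\<close>. Thus negated coefficients reproduce a
  finitely supported vector up to half its norm.\<close>

lemma perturbed_basis_residual:
  assumes b: "bessel f D" and r: "r * sqrt D = 1/2" "r \<ge> 0" "D \<ge> 0" and F: "finite F"
  shows "l2_norm (\<lambda>i. truncate F a i + (\<Sum>j\<in>F. a j * perturbed_basis r f j i)) \<le> l2_norm (truncate F a) / 2"
proof -
  have f: "\<And>j. f j \<in> l2_module" using b by (simp add: bessel_def)
  have "l2_norm (\<lambda>i. truncate F a i + (\<Sum>j\<in>F. a j * perturbed_basis r f j i))
      = r * l2_norm (\<lambda>i. \<Sum>j\<in>F. a j * f j i)"
    using r(2) by (simp add: sum_perturbed_basis[OF F] l2_norm_scaleR l2_sum f)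
  also have "\<dots> \<le> r * (sqrt D * l2_norm (truncate F a))"
    by (intro mult_left_mono bessel_synthesis_norm b F r)
  also have "\<dots> = l2_norm (truncate F a) / 2" using r(1) by (simp flip: mult.assoc)
  finally show ?thesis .
qed

text \<open>The residual estimate and the triangle inequality; half of the left side is
  absorbed.\<close>

lemma perturbed_basis_lower:
  assumes b: "bessel f D" and r: "r * sqrt D = 1/2" "r \<ge> 0" "D \<ge> 0" and F: "finite F"
  shows "l2_norm (truncate F a) \<le> 2 * l2_norm (\<lambda>i. \<Sum>j\<in>F. a j * perturbed_basis r f j i)"
proof -
  let ?z = "\<lambda>i. \<Sum>j\<in>F. a j * perturbed_basis r f j i"
  have z: "?z \<in> l2_module" using b by (intro l2_sum perturbed_basis_l2) (simp add: bessel_def)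
  have "truncate F a = (\<lambda>i. (truncate F a i + ?z i) + (-1) *\<^sub>R ?z i)" by auto
  then have "l2_norm (truncate F a) = l2_norm (\<lambda>i. (truncate F a i + ?z i) + (-1) *\<^sub>R ?z i)"
    by (rule arg_cong)
  also have "\<dots> \<le> l2_norm (\<lambda>i. truncate F a i + ?z i) + l2_norm (\<lambda>i. (-1) *\<^sub>R ?z i)"
    by (intro l2_norm_add_le l2_add l2_scaleR truncate_l2 F z)
  also have "l2_norm (\<lambda>i. (-1) *\<^sub>R ?z i) = l2_norm ?z" using l2_norm_scaleR[OF z, of "-1"] by simp
  also have "l2_norm (\<lambda>i. truncate F a i + ?z i) \<le> l2_norm (truncate F a) / 2"
    by (rule perturbed_basis_residual[OF assms])
  finally show ?thesis by simp
qed

text \<open>The Neumann iteration for inverting the perturbed operator, with each remaining error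
  truncated so that every combination stays finite.\<close>

lemma perturbed_basis_approx:
  fixes f :: "nat \<Rightarrow> nat \<Rightarrow> 'a::unital_cstar_algebra"
  assumes b: "bessel f D" and r: "r * sqrt D = 1/2" "r \<ge> 0" "D \<ge> 0"
    and y: "y \<in> l2_module" and e: "e > 0"
  shows "\<exists>N a. l2_norm (\<lambda>i. y i - (\<Sum>j<N. a j * perturbed_basis r f j i)) \<le> l2_norm y / 2 ^ n + 2 * e"
proof (induction n)
  case 0
  show ?case using e by (intro exI[of _ 0] exI[of _ "\<lambda>_. 0"]) simp
next
  case (Suc n)
  let ?h = "perturbed_basis r f"
  have h: "?h j \<in> l2_module" for j using b by (intro perturbed_basis_l2) (simp add: bessel_def)
  obtain N a where Na: "l2_norm (\<lambda>i. y i - (\<Sum>j<N. a j * ?h j i)) \<le> l2_norm y / 2 ^ n + 2 * e"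
    using Suc by blast
  define w where "w = (\<lambda>i. y i - (\<Sum>j<N. a j * ?h j i))"
  have w: "w \<in> l2_module" unfolding w_def by (intro l2_diff l2_sum y h)
  obtain m where m: "l2_norm (\<lambda>i. w i - truncate {..<m} w i) < e" using truncate_dense[OF w e] .
  define M where "M = max N m"
  \<comment> \<open>The minus sign appears because the operator is close to minus the identity: an
    approximate preimage of the truncated error is its negative.\<close>
  define c where "c j = truncate {..<N} a j - truncate {..<m} w j" for j
  let ?t = "truncate {..<m} w"
  let ?z = "\<lambda>i. \<Sum>j<m. w j * ?h j i"
  \<comment> \<open>Pads a sum with zero coefficients to the common length \<open>M\<close>.\<close>
  have tr: "(\<Sum>j<k. d j * ?h j i) = (\<Sum>j<M. truncate {..<k} d j * ?h j i)" if "k \<le> M" for k d i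
    using that by (intro sum.mono_neutral_cong_left) (auto simp: truncate_def)
  have "(\<Sum>j<M. c j * ?h j i) = (\<Sum>j<N. a j * ?h j i) - ?z i" for i
    unfolding tr[of N, unfolded M_def, simplified, folded M_def] tr[of m, unfolded M_def, simplified, folded M_def] c_def
    by (simp add: left_diff_distrib sum_subtractf)
  then have "(\<lambda>i. y i - (\<Sum>j<M. c j * ?h j i)) = (\<lambda>i. (w i - ?t i) + (?t i + ?z i))"
    by (auto simp: w_def)
  then have "l2_norm (\<lambda>i. y i - (\<Sum>j<M. c j * ?h j i)) \<le> l2_norm (\<lambda>i. w i - ?t i) + l2_norm (\<lambda>i. ?t i + ?z i)"
    using l2_norm_add_le[of "\<lambda>i. w i - ?t i" "\<lambda>i. ?t i + ?z i"] w h
    by (simp add: l2_diff l2_add l2_sum truncate_l2)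
  also have "\<dots> \<le> e + l2_norm ?t / 2"
    using m perturbed_basis_residual[OF b r, of "{..<m}" w] by simp
  also have "\<dots> \<le> e + l2_norm w / 2" using l2_norm_truncate_le[OF w, of "{..<m}"] by simp
  \<comment> \<open>The truncation errors do not accumulate:
    \<open>e + (2 * e) / 2 = 2 * e\<close>.\<close>
  also have "\<dots> \<le> l2_norm y / 2 ^ Suc n + 2 * e" using Na by (simp add: w_def field_simps)
  finally show ?case by blast
qed

lemma generating_perturbed_basis:
  fixes f :: "nat \<Rightarrow> nat \<Rightarrow> 'a::unital_cstar_algebra"
  assumes b: "bessel f D" and r: "r * sqrt D = 1/2" "r \<ge> 0" "D \<ge> 0"
  shows "generating (perturbed_basis r f)"
  unfolding generating_def
proof (intro conjI allI ballI impI)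
  show "perturbed_basis r f j \<in> l2_module" for j using b by (intro perturbed_basis_l2) (simp add: bessel_def)
next
  fix y :: "nat \<Rightarrow> 'a" and e :: real assume y: "y \<in> l2_module" and e: "e > 0"
  have "(\<lambda>n. l2_norm y * (1/2) ^ n) \<longlonglongrightarrow> l2_norm y * 0" by (intro tendsto_intros LIMSEQ_power_zero) auto
  then have "\<forall>\<^sub>F n in sequentially. l2_norm y * (1/2) ^ n < e/2" using e by (intro order_tendstoD) auto
  then obtain n where n: "l2_norm y / 2 ^ n < e/2" by (auto simp: eventually_sequentially power_divide)
  obtain N a where "l2_norm (\<lambda>i. y i - (\<Sum>j<N. a j * perturbed_basis r f j i)) \<le> l2_norm y / 2 ^ n + 2 * (e/4)"
    using perturbed_basis_approx[OF b r y, of "e/4"] e by fastforce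
  then have "l2_norm (\<lambda>i. y i - (\<Sum>j<N. a j * perturbed_basis r f j i)) < e" using n by linarith
  then show "\<exists>F a. finite F \<and> l2_norm (\<lambda>i. y i - (\<Sum>j\<in>F. a j * perturbed_basis r f j i)) < e" by blast
qed

text \<open>The lower bound controls each single coefficient by the norms of the partial sums, so a
  vanishing combination forces \<open>a j = 0\<close> for every \<open>j\<close> in
  \<open>S\<close>.\<close>

lemma riesz_basis_perturbed_basis:
  fixes f :: "nat \<Rightarrow> nat \<Rightarrow> 'a::unital_cstar_algebra"
  assumes b: "bessel f D" and r: "r * sqrt D = 1/2" "r \<ge> 0" "D \<ge> 0"
  shows "riesz_basis (perturbed_basis r f)"
  unfolding riesz_basis_def
proof (intro conjI allI iffI ballI)
  let ?h = "perturbed_basis r f"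
  have "r * r * D = (r * sqrt D) * (r * sqrt D)" using r(3) by simp
  also have "\<dots> = 1/4" unfolding r(1) by simp
  finally show "standard_frame ?h" by (rule standard_frame_perturbed_basis[OF b])
  show "generating ?h" by (rule generating_perturbed_basis[OF b r])
  fix S a
  {
    assume c: "combination_eq_0 S a ?h"
    fix j assume j: "j \<in> S"
    have lim: "(\<lambda>n. 2 * l2_norm (\<lambda>i. \<Sum>j\<in>S \<inter> {..<n}. a j * ?h j i)) \<longlonglongrightarrow> 2 * 0"
      using c unfolding combination_eq_0_def by (intro tendsto_intros)
    \<comment> \<open>From \<open>n = Suc j\<close> on, the index \<open>j\<close> lies in
      \<open>S \<inter> {..<n}\<close>, so the truncation retains \<open>a j\<close>.\<close>
    have "norm (a j) \<le> 2 * l2_norm (\<lambda>i. \<Sum>j\<in>S \<inter> {..<n}. a j * ?h j i)" if "n \<ge> Suc j" for n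
    proof -
      have "norm (a j) = norm (truncate (S \<inter> {..<n}) a j)" using j that by (simp add: truncate_def)
      also have "\<dots> \<le> l2_norm (truncate (S \<inter> {..<n}) a)" by (intro norm_coordinate_le truncate_l2) simp
      also have "\<dots> \<le> 2 * l2_norm (\<lambda>i. \<Sum>j\<in>S \<inter> {..<n}. a j * ?h j i)"
        by (intro perturbed_basis_lower[OF b r]) simp
      finally show ?thesis .
    qed
    then have "norm (a j) \<le> 2 * 0" by (intro LIMSEQ_le_const[OF lim]) blast
    then show "(\<lambda>i. a j * ?h j i) = (\<lambda>i. 0)" by simp
  next
    assume "\<forall>j\<in>S. (\<lambda>i. a j * ?h j i) = (\<lambda>i. 0)"
    then have "(\<Sum>j\<in>S \<inter> {..<n}. a j * ?h j i) = 0" for n i by (intro sum.neutral) (metis IntD1)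
    then show "combination_eq_0 S a ?h" by (simp add: combination_eq_0_def)
  }
qed

theorem theorem7p9:
  fixes f :: "nat \<Rightarrow> nat \<Rightarrow> 'a::unital_cstar_algebra"
  assumes "standard_frame f"
  shows "\<exists>(c::complex) g h. orthonormal_basis g \<and> riesz_basis h \<and>
           (\<forall>j. f j = (\<lambda>i. c *\<^sub>C (g j i + h j i)))"
proof -
  obtain D where D: "D > 0" "bessel f D" using standard_frame_bessel[OF assms] .
  define r where "r = 1 / (2 * sqrt D)"
  have r: "r > 0" "r * sqrt D = 1/2" using D(1) by (simp_all add: r_def)
  have "riesz_basis (perturbed_basis r f)"
    by (rule riesz_basis_perturbed_basis[OF D(2) r(2)]) (use r D in auto)
  moreover have "f j = (\<lambda>i. complex_of_real (inverse r) *\<^sub>C (std_basis j i + perturbed_basis r f j i))" for j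
    using r by (simp add: scaleC_of_real perturbed_basis_def del: of_real_inverse)
  ultimately show ?thesis using orthonormal_basis_std_basis by blast
qed

end
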